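(* Let $(E,\|\cdot\|)$ be a $\mathcal{T}_{\varepsilon,\lambda}$-complete random normed module over $\mathbb{K}$ with base $(\Omega,\mathcal{F},P)$, let $G$ be an $L^0$-convexly compact subset of $E$ with random normal structure, and let $\mathcal{T}$ be a family of surjective isometric mappings from $G$ to $G$. Then $\mathcal{T}$ has a common fixed point in $C(G,G)$, i.e. there is $x\in C(G,G)$ with $T(x)=x$ for all $T\in\mathcal{T}$.
   Context: $(\Omega,\mathcal{F},P)$ is a probability space and $\mathbb{K}\in\{\mathbb{R},\mathbb{C}\}$. $L^0(\mathcal{F},\mathbb{K})$ is the algebra of a.s.-equivalence classes of $\mathbb{K}$-valued $\mathcal{F}$-measurable random variables, $L^0(\mathcal{F})=L^0(\mathcal{F},\mathbb{R})$, ordered by $\xi\le\eta$ iff $\xi\leq\eta$ a.s., and $L^0_+(\mathcal{F})=\{\xi\in L^0(\mathcal{F}):\xi\ge 0\}$. $\bigvee,\bigwedge$ denote supremum and infimum in the complete lattice $\bar L^0(\mathcal{F})$ of classes of extended real-valued random variables. $\xi>\eta$ means $\xi\ge\eta$ and $\xi\ne\eta$; "$\xi>\eta$ on $A$" means $\xi(\omega)>\eta(\omega)$ for almost all $\omega\in A$; $(\xi>\eta)=\{\omega:\xi(\omega)>\eta(\omega)\}$ (up to null sets). A random normed module (RN module) over $\mathbb{K}$ with base $(\Omega,\mathcal{F},P)$ is an $L^0(\mathcal{F},\mathbb{K})$-module $E$ with a map $\|\cdot\|:E\to L^0_+(\mathcal{F})$ such that $\|\xi x\|=|\xi|\|x\|$,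 $\|x+y\|\le\|x\|+\|y\|$, and $\|x\|=0$ implies $x=\theta$ (the null element). The $(\varepsilon,\lambda)$-topology $\mathcal{T}_{\varepsilon,\lambda}$ is the metrizable linear topology with local base at $\theta$ the sets $\{x: P\{\|x\|<\varepsilon\}>1-\lambda\}$, $\varepsilon>0$, $0<\lambda<1$ ($x_n\to x$ iff $\|x_n-x\|\to0$ in probability). $G\subset E$ is a.s. bounded if $\bigvee\{\|g\|:g\in G\}\in L^0_+(\mathcal F)$, and $L^0$-convex if $\xi x+(1-\xi)y\in G$ for all $x,y\in G$ and $\xi\in L^0_+(\mathcal F)$ with $0\le\xi\le1$. A nonempty $\mathcal{T}_{\varepsilon,\lambda}$-closed $L^0$-convex $G\subset E$ is $L^0$-convexly compact if every family of $\mathcal{T}_{\varepsilon,\lambda}$-closed $L^0$-convex subsets of $G$ with the finite intersection property has nonempty intersection (such $G$ is automatically a.s. bounded). For $H\subset E$ nonempty a.s. bounded and $G\subset E$ nonempty, $R(H,x)=\bigvee\{\|x-y\|:y\in H\}$ for $x\in E$, $R(H,G)=\bigwedge\{R(H,x):x\in G\}$, and $C(H,G)=\{x\in G:R(H,x)=R(H,G)\}$; $C(G,G)$ is the random Chebyshev center of $G$. $D(H)=\bigvee\{\|x-y\|:x,y\in H\}$. A nonempty $\mathcal{T}_{\varepsilon,\lambda}$-closed $L^0$-convex $G\subset E$ has random normal structure if for each a.s. bounded $\mathcal{T}_{\varepsilon,\lambda}$-closed $L^0$-convex $H\subset G$ with $D(H)>0$ there is $z\in H$ with $R(H,z)<D(H)$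 on $(D(H)>0)$. $T:G\to G$ is isometric if $\|Tx-Ty\|=\|x-y\|$ for all $x,y\in G$. *)

theory Defs
  imports "HOL-Probability.Probability"
begin

text \<open>
  Elements of the spaces \<open>L\<^sup>0\<close> are represented by measurable functions; equality and order of
  classes are almost-everywhere equality and order of representatives.  The scalar field
  \<open>'k\<close> ranges over the real normed fields that are Euclidean spaces.  Both \<^typ>\<open>real\<close> and
  \<^typ>\<open>complex\<close> are instances, and up to isometric isomorphism they are the only ones.
\<close>

locale rn_module = prob_space M
  for M :: "'w measure" +
  fixes smul :: "('w \<Rightarrow> 'k::{real_normed_field,euclidean_space}) \<Rightarrow> 'e::ab_group_add \<Rightarrow> 'e"
    and nrm :: "'e \<Rightarrow> 'w \<Rightarrow> real"
  assumes smul_cong: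
      "\<lbrakk>\<xi> \<in> borel_measurable M; \<eta> \<in> borel_measurable M; AE w in M. \<xi> w = \<eta> w\<rbrakk>
        \<Longrightarrow> smul \<xi> x = smul \<eta> x"
    and smul_add_right:
      "\<xi> \<in> borel_measurable M \<Longrightarrow> smul \<xi> (x + y) = smul \<xi> x + smul \<xi> y"
    and smul_add_left:
      "\<lbrakk>\<xi> \<in> borel_measurable M; \<eta> \<in> borel_measurable M\<rbrakk>
        \<Longrightarrow> smul (\<lambda>w. \<xi> w + \<eta> w) x = smul \<xi> x + smul \<eta> x"
    and smul_smul:
      "\<lbrakk>\<xi> \<in> borel_measurable M; \<eta> \<in> borel_measurable M\<rbrakk>
        \<Longrightarrow> smul \<xi> (smul \<eta> x) = smul (\<lambda>w. \<xi> w * \<eta> w) x"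
    and smul_one: "smul (\<lambda>_. 1) x = x"
    and nrm_measurable: "nrm x \<in> borel_measurable M"
    and nrm_nonneg: "AE w in M. 0 \<le> nrm x w"
    and nrm_smul:
      "\<xi> \<in> borel_measurable M \<Longrightarrow> AE w in M. nrm (smul \<xi> x) w = norm (\<xi> w) * nrm x w"
    and nrm_triangle: "AE w in M. nrm (x + y) w \<le> nrm x w + nrm y w"
    and nrm_eq_zero: "AE w in M. nrm x w = 0 \<Longrightarrow> x = 0"

definition el_ball :: "'w measure \<Rightarrow> ('e::ab_group_add \<Rightarrow> 'w \<Rightarrow> real) \<Rightarrow> 'e \<Rightarrow> real \<Rightarrow> real \<Rightarrow> 'e set"
  where "el_ball M nrm x \<epsilon> l =
    {y. measure M {w \<in> space M. nrm (y - x) w < \<epsilon>} > 1 - l}"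

definition el_topology :: "'w measure \<Rightarrow> ('e::ab_group_add \<Rightarrow> 'w \<Rightarrow> real) \<Rightarrow> 'e topology"
  where "el_topology M nrm = topology (\<lambda>U.
    \<forall>x\<in>U. \<exists>\<epsilon>>0. \<exists>l. 0 < l \<and> l < 1 \<and> el_ball M nrm x \<epsilon> l \<subseteq> U)"

lemma (in rn_module) el_ball_mono:
  assumes "\<epsilon> \<le> \<epsilon>'" "l \<le> l'"
  shows "el_ball M nrm x \<epsilon> l \<subseteq> el_ball M nrm x \<epsilon>' l'"
proof
  fix y assume y: "y \<in> el_ball M nrm x \<epsilon> l"
  note nrm_measurable[measurable]
  have "prob {w \<in> space M. nrm (y - x) w < \<epsilon>} \<le> prob {w \<in> space M. nrm (y - x) w < \<epsilon>'}"
    using assms by (intro finite_measure_mono) auto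
  then show "y \<in> el_ball M nrm x \<epsilon>' l'"
    using y assms by (simp add: el_ball_def)
qed

lemma (in rn_module) openin_el_topology:
  "openin (el_topology M nrm) U \<longleftrightarrow>
    (\<forall>x\<in>U. \<exists>\<epsilon>>0. \<exists>l. 0 < l \<and> l < 1 \<and> el_ball M nrm x \<epsilon> l \<subseteq> U)"
proof -
  let ?O = "\<lambda>U. \<forall>x\<in>U. \<exists>\<epsilon>>0. \<exists>l. 0 < l \<and> l < 1 \<and> el_ball M nrm x \<epsilon> l \<subseteq> U"
  have Int: "?O (S \<inter> T)" if S: "?O S" and T: "?O T" for S T
  proof
    fix x assume x: "x \<in> S \<inter> T"
    obtain e1 l1 where 1: "e1 > 0" "0 < l1" "l1 < 1" "el_ball M nrm x e1 l1 \<subseteq> S"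
      using bspec[OF S, of x] x by auto
    obtain e2 l2 where 2: "e2 > 0" "0 < l2" "l2 < 1" "el_ball M nrm x e2 l2 \<subseteq> T"
      using bspec[OF T, of x] x by auto
    have "el_ball M nrm x (min e1 e2) (min l1 l2) \<subseteq> S \<inter> T"
      using order_trans[OF el_ball_mono 1(4), of "min e1 e2" "min l1 l2"]
        order_trans[OF el_ball_mono 2(4), of "min e1 e2" "min l1 l2"] by simp
    moreover have "0 < min e1 e2" "0 < min l1 l2" "min l1 l2 < 1"
      using 1 2 by auto
    ultimately show "\<exists>\<epsilon>>0. \<exists>l. 0 < l \<and> l < 1 \<and> el_ball M nrm x \<epsilon> l \<subseteq> S \<inter> T"
      by (intro exI conjI)
  qed
  have Un: "?O (\<Union>\<K>)" if \<K>: "\<forall>K\<in>\<K>. ?O K" for \<K>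
  proof
    fix x assume "x \<in> \<Union>\<K>"
    then obtain K where K: "K \<in> \<K>" "x \<in> K" by (rule UnionE)
    obtain e l where el: "e > 0" "0 < l" "l < 1" "el_ball M nrm x e l \<subseteq> K"
      using bspec[OF bspec[OF \<K> K(1)] K(2)] by auto
    have "el_ball M nrm x e l \<subseteq> \<Union>\<K>"
      using el(4) Union_upper[OF K(1)] by (rule order_trans)
    with el(1-3) show "\<exists>\<epsilon>>0. \<exists>l. 0 < l \<and> l < 1 \<and> el_ball M nrm x \<epsilon> l \<subseteq> \<Union>\<K>"
      by (intro exI conjI)
  qed
  have "istopology ?O"
    unfolding istopology_def
    by (intro conjI allI impI) (fact Int, fact Un)
  then show ?thesis
    by (simp add: el_topology_def)
qed

text \<open>The \<open>(\<epsilon>,\<lambda>)\<close>-topology is metrizable, so completeness is sequential completeness.\<close>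

definition el_Cauchy :: "'w measure \<Rightarrow> ('e::ab_group_add \<Rightarrow> 'w \<Rightarrow> real) \<Rightarrow> (nat \<Rightarrow> 'e) \<Rightarrow> bool"
  where "el_Cauchy M nrm X \<longleftrightarrow>
    (\<forall>\<epsilon>>0. \<forall>l. 0 < l \<and> l < 1 \<longrightarrow>
      (\<exists>N. \<forall>m\<ge>N. \<forall>n\<ge>N. X m \<in> el_ball M nrm (X n) \<epsilon> l))"

definition el_complete :: "'w measure \<Rightarrow> ('e::ab_group_add \<Rightarrow> 'w \<Rightarrow> real) \<Rightarrow> bool"
  where "el_complete M nrm \<longleftrightarrow>
    (\<forall>X. el_Cauchy M nrm X \<longrightarrow> (\<exists>x. limitin (el_topology M nrm) X x sequentially))"

definition L0_convex ::
  "'w measure \<Rightarrow> (('w \<Rightarrow> 'k::{real_normed_field,euclidean_space}) \<Rightarrow> 'e::ab_group_add \<Rightarrow> 'e)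
    \<Rightarrow> 'e set \<Rightarrow> bool"
  where "L0_convex M smul G \<longleftrightarrow>
    (\<forall>x\<in>G. \<forall>y\<in>G. \<forall>\<xi>::'w \<Rightarrow> real.
      \<xi> \<in> borel_measurable M \<and> (AE w in M. 0 \<le> \<xi> w \<and> \<xi> w \<le> 1) \<longrightarrow>
      smul (\<lambda>w. of_real (\<xi> w)) x + smul (\<lambda>w. of_real (1 - \<xi> w)) y \<in> G)"

definition L0_convexly_compact ::
  "'w measure \<Rightarrow> (('w \<Rightarrow> 'k::{real_normed_field,euclidean_space}) \<Rightarrow> 'e::ab_group_add \<Rightarrow> 'e)
    \<Rightarrow> ('e \<Rightarrow> 'w \<Rightarrow> real) \<Rightarrow> 'e set \<Rightarrow> bool"
  where "L0_convexly_compact M smul nrm G \<longleftrightarrow>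
    G \<noteq> {} \<and> closedin (el_topology M nrm) G \<and> L0_convex M smul G \<and>
    (\<forall>\<A>. (\<forall>A\<in>\<A>. A \<subseteq> G \<and> closedin (el_topology M nrm) A \<and> L0_convex M smul A) \<and>
          (\<forall>\<F>. \<F> \<subseteq> \<A> \<and> finite \<F> \<longrightarrow> \<Inter>\<F> \<noteq> {})
        \<longrightarrow> \<Inter>\<A> \<noteq> {})"

text \<open>
  Suprema and infima in the complete lattice of classes of extended real random variables;
  they are determined only up to null sets, and a representative is chosen.  Note that these
  are not pointwise suprema, and that \<^const>\<open>esssup\<close> is a different notion (the essential
  supremum of a single function, a number).
\<close>

definition L0_Sup :: "'w measure \<Rightarrow> ('w \<Rightarrow> ereal) set \<Rightarrow> 'w \<Rightarrow> ereal"
  where "L0_Sup M F = (SOME s. s \<in> borel_measurable M \<and>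
    (\<forall>f\<in>F. AE w in M. f w \<le> s w) \<and>
    (\<forall>t\<in>borel_measurable M. (\<forall>f\<in>F. AE w in M. f w \<le> t w) \<longrightarrow> (AE w in M. s w \<le> t w)))"

definition L0_Inf :: "'w measure \<Rightarrow> ('w \<Rightarrow> ereal) set \<Rightarrow> 'w \<Rightarrow> ereal"
  where "L0_Inf M F = (SOME s. s \<in> borel_measurable M \<and>
    (\<forall>f\<in>F. AE w in M. s w \<le> f w) \<and>
    (\<forall>t\<in>borel_measurable M. (\<forall>f\<in>F. AE w in M. t w \<le> f w) \<longrightarrow> (AE w in M. t w \<le> s w)))"

text \<open>The lower bound excludes the empty set, whose supremum is \<open>-\<infinity>\<close>.\<close>

definition as_bounded :: "'w measure \<Rightarrow> ('e \<Rightarrow> 'w \<Rightarrow> real) \<Rightarrow> 'e set \<Rightarrow> bool"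
  where "as_bounded M nrm G \<longleftrightarrow>
    (AE w in M. 0 \<le> L0_Sup M {\<lambda>w. ereal (nrm g w) | g. g \<in> G} w \<and>
                L0_Sup M {\<lambda>w. ereal (nrm g w) | g. g \<in> G} w < \<infinity>)"

definition rad_pt :: "'w measure \<Rightarrow> ('e::ab_group_add \<Rightarrow> 'w \<Rightarrow> real) \<Rightarrow> 'e set \<Rightarrow> 'e \<Rightarrow> 'w \<Rightarrow> ereal"
  where "rad_pt M nrm H x = L0_Sup M {\<lambda>w. ereal (nrm (x - y) w) | y. y \<in> H}"

definition rad_set :: "'w measure \<Rightarrow> ('e::ab_group_add \<Rightarrow> 'w \<Rightarrow> real) \<Rightarrow> 'e set \<Rightarrow> 'e set \<Rightarrow> 'w \<Rightarrow> ereal"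
  where "rad_set M nrm H G = L0_Inf M {rad_pt M nrm H x | x. x \<in> G}"

definition random_center :: "'w measure \<Rightarrow> ('e::ab_group_add \<Rightarrow> 'w \<Rightarrow> real) \<Rightarrow> 'e set \<Rightarrow> 'e set \<Rightarrow> 'e set"
  where "random_center M nrm H G =
    {x \<in> G. AE w in M. rad_pt M nrm H x w = rad_set M nrm H G w}"

definition random_diam :: "'w measure \<Rightarrow> ('e::ab_group_add \<Rightarrow> 'w \<Rightarrow> real) \<Rightarrow> 'e set \<Rightarrow> 'w \<Rightarrow> ereal"
  where "random_diam M nrm H = L0_Sup M {\<lambda>w. ereal (nrm (x - y) w) | x y. x \<in> H \<and> y \<in> H}"

text \<open>In \<open>L\<^sup>0\<close>, \<open>\<xi> > 0\<close> means \<open>\<xi> \<ge> 0\<close> and \<open>\<xi> \<noteq> 0\<close>, not almost sure strict positivity.\<close>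

definition random_normal_structure ::
  "'w measure \<Rightarrow> (('w \<Rightarrow> 'k::{real_normed_field,euclidean_space}) \<Rightarrow> 'e::ab_group_add \<Rightarrow> 'e)
    \<Rightarrow> ('e \<Rightarrow> 'w \<Rightarrow> real) \<Rightarrow> 'e set \<Rightarrow> bool"
  where "random_normal_structure M smul nrm G \<longleftrightarrow>
    G \<noteq> {} \<and> closedin (el_topology M nrm) G \<and> L0_convex M smul G \<and>
    (\<forall>H. H \<subseteq> G \<and> as_bounded M nrm H \<and> closedin (el_topology M nrm) H \<and> L0_convex M smul H \<and>
         (AE w in M. 0 \<le> random_diam M nrm H w) \<and> \<not> (AE w in M. random_diam M nrm H w = 0)
       \<longrightarrow> (\<exists>z\<in>H. AE w in M. 0 < random_diam M nrm H w \<longrightarrow>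
                rad_pt M nrm H z w < random_diam M nrm H w))"

definition random_isometric ::
  "'w measure \<Rightarrow> ('e::ab_group_add \<Rightarrow> 'w \<Rightarrow> real) \<Rightarrow> 'e set \<Rightarrow> ('e \<Rightarrow> 'e) \<Rightarrow> bool"
  where "random_isometric M nrm G T \<longleftrightarrow>
    (\<forall>x\<in>G. \<forall>y\<in>G. AE w in M. nrm (T x - T y) w = nrm (x - y) w)"

end

theory Submission imports Defs begin

text \<open>
  The argument is that of Brodskii and Milman.  Points of \<open>G\<close> with minimal radius exist by
  compactness, and they form a closed convex set that every surjective isometry of \<open>G\<close> maps onto
  itself.  By Zorn's lemma this set contains a minimal nonempty closed convex set \<open>K\<close> with
  \<open>T ` K = K\<close> for all \<open>T\<close>; compactness keeps the intersection of a chain nonempty, and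
  injectivity keeps it invariant.  The Chebyshev center of \<open>K\<close> in itself has the same
  properties (\<open>centers_closed_convex\<close>, \<open>isometry_image_centers\<close>), so it is all of \<open>K\<close>.  Hence all points of
  \<open>K\<close> have the same radius, and this is compatible with normal structure only if the diameter of
  \<open>K\<close> is zero (\<open>all_centers_singleton\<close>).  The single point of \<open>K\<close> is fixed by all \<open>T\<close>.

  Normal structure speaks about almost surely bounded sets only, so one has to know
  that a convexly compact set is bounded (\<open>convexly_compact_bounded\<close>).  This is the
  laborious part.  Compactness bounds every \<open>L\<^sup>0\<close>-linear functional on \<open>G\<close>; the passage from
  functionals to the norm is a uniform boundedness argument, carried out as a gliding hump,
  and it requires norming functionals, that is, a Hahn--Banach theorem for random normed modules
  (\<open>L0_Hahn_Banach\<close>).  Its proof finds a minimal sublinear functional and shows that such a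
  functional is linear.

  Suprema are essential suprema of uncountable families.  They are reached by countable
  subfamilies (\<open>countable_essential_Sup\<close>), and pasting two elements along an event makes the
  families in question directed.
\<close>

section \<open>Essential suprema\<close>

text \<open>
  The probability of the union of a countable subfamily has a supremum, and it is attained, because
  the union of countably many almost optimal subfamilies is again countable.  A set of the
  family that met the complement of an optimal union in a non-null set would improve it.
\<close>

lemma (in prob_space) essential_union:
  fixes D :: "'i \<Rightarrow> 'a set"
  assumes D: "\<And>i. i \<in> I \<Longrightarrow> D i \<in> events"
  obtains C where "C \<subseteq> I" "countable C"
    "\<And>i. i \<in> I \<Longrightarrow> prob (D i - (\<Union>j\<in>C. D j)) = 0"
proof -
  define v where "v C = prob (\<Union>j\<in>C. D j)" for C
  define \<C> where "\<C> = {C. C \<subseteq> I \<and> countable C}"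
  define m where "m = (SUP C\<in>\<C>. v C)"
  have UD: "(\<Union>j\<in>C. D j) \<in> events" if "C \<in> \<C>" for C
    using that D by (auto simp: \<C>_def intro!: sets.countable_UN')
  have bdd: "bdd_above (v ` \<C>)" by (auto simp: v_def intro!: bdd_aboveI[of _ 1])
  have ne: "{} \<in> \<C>" by (simp add: \<C>_def)
  have "\<exists>C\<in>\<C>. m - 1 / Suc n < v C" for n
  proof -
    have "m - 1 / Suc n < m" by simp
    then show ?thesis unfolding m_def using ne bdd by (subst (asm) less_cSUP_iff) auto
  qed
  then obtain Cn where Cn: "\<And>n. Cn n \<in> \<C>" "\<And>n. m - 1 / Suc n < v (Cn n)" by metis
  define C where "C = (\<Union>n. Cn n)"
  have C: "C \<in> \<C>" using Cn(1) by (auto simp: C_def \<C>_def)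
  have mC: "m \<le> v C"
  proof (rule field_le_epsilon)
    fix e :: real assume "0 < e"
    then obtain n where "1 / Suc n < e" using nat_approx_posE by blast
    moreover have "v (Cn n) \<le> v C"
      unfolding v_def using UD[OF C] by (intro finite_measure_mono) (auto simp: C_def)
    ultimately show "m \<le> v C + e" using Cn(2)[of n] by linarith
  qed
  have "prob (D i - (\<Union>j\<in>C. D j)) = 0" if i: "i \<in> I" for i
  proof -
    have C': "insert i C \<in> \<C>" using C i by (auto simp: \<C>_def)
    have "v (insert i C) \<le> m" unfolding m_def by (intro cSUP_upper C' bdd)
    then have "v (insert i C) \<le> v C" using mC by simp
    moreover have "v (insert i C) = v C + prob (D i - (\<Union>j\<in>C. D j))"
      using D[OF i] UD[OF C] unfolding v_def
      by (subst finite_measure_Union[symmetric]) (auto intro!: arg_cong[where f=prob])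
    ultimately show ?thesis using measure_nonneg[of M "D i - (\<Union>j\<in>C. D j)"] by linarith
  qed
  then show ?thesis using C that by (auto simp: \<C>_def)
qed

text \<open>
  A function is determined by its superlevel sets at rational heights, so it is enough to take
  the countably many functions that exhaust the essential unions of those sets.
\<close>

lemma (in prob_space) countable_essential_Sup:
  fixes F :: "('a \<Rightarrow> ereal) set"
  assumes F: "F \<subseteq> borel_measurable M"
  obtains C where "C \<subseteq> F" "countable C" "\<And>f. f \<in> F \<Longrightarrow> AE w in M. f w \<le> (SUP c\<in>C. c w)"
proof -
  define D where "D q f = {w \<in> space M. ereal (of_rat q) < f w}" for q :: rat and f :: "'a \<Rightarrow> ereal"
  have D: "D q f \<in> events" if "f \<in> F" for q f
    proof -
    have [measurable]: "f \<in> borel_measurable M" using F that by auto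
    show ?thesis unfolding D_def by measurable
  qed
  have "\<exists>C. C \<subseteq> F \<and> countable C \<and> (\<forall>f\<in>F. prob (D q f - (\<Union>c\<in>C. D q c)) = 0)" for q
    using essential_union[where I=F and D="D q", OF D] by metis
  then obtain Cq where Cq: "\<And>q. Cq q \<subseteq> F" "\<And>q. countable (Cq q)"
    "\<And>q f. f \<in> F \<Longrightarrow> prob (D q f - (\<Union>c\<in>Cq q. D q c)) = 0" by metis
  define C where "C = (\<Union>q. Cq q)"
  have C: "C \<subseteq> F" "countable C" using Cq(1,2) by (auto simp: C_def)
  have "AE w in M. f w \<le> (SUP c\<in>C. c w)" if f: "f \<in> F" for f
  proof -
    have "AE w in M. w \<notin> D q f - (\<Union>c\<in>Cq q. D q c)" for q
    proof -
      have "D q f - (\<Union>c\<in>Cq q. D q c) \<in> events"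
        using D f Cq(1,2) by (intro sets.Diff sets.countable_UN') auto
      then show ?thesis using Cq(3)[OF f, of q] by (simp add: prob_eq_0)
    qed
    then have "AE w in M. \<forall>q. w \<notin> D q f - (\<Union>c\<in>Cq q. D q c)" by (simp add: AE_all_countable)
    with AE_space show ?thesis
    proof eventually_elim
      case (elim w)
      show ?case
      proof (rule ccontr)
        assume "\<not> ?thesis"
        then have "(SUP c\<in>C. c w) < f w" by simp
        then obtain r where r: "(SUP c\<in>C. c w) < ereal r" "ereal r < f w" using ereal_dense2 by blast
        then obtain r' where r': "ereal r < ereal r'" "ereal r' < f w" using ereal_dense2 by blast
        then obtain q where q: "r < of_rat q" "of_rat q < r'" using of_rat_dense by auto
        have "w \<in> D q f" using r'(2) q(2) elim(1) less_trans[of "ereal (of_rat q)" "ereal r'"]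
          by (auto simp: D_def)
        then obtain c where c: "c \<in> Cq q" "w \<in> D q c" using elim(2) by auto
        have "c w \<le> (SUP c\<in>C. c w)" using c(1) by (intro SUP_upper) (auto simp: C_def)
        then have "ereal (of_rat q) < ereal r" using c(2) r(1) unfolding D_def
          by (metis (mono_tags, lifting) mem_Collect_eq less_le_trans less_trans)
        with q(1) show False by simp
      qed
    qed
  qed
  with C that show ?thesis by blast
qed

text \<open>
  The pointwise supremum over a countable dominating subfamily has the properties by which
  \<^const>\<open>L0_Sup\<close> is chosen, so the chosen representative has them too.
\<close>

lemma (in prob_space) L0_Sup_spec:
  assumes F: "F \<subseteq> borel_measurable M"
  shows L0_Sup_measurable: "L0_Sup M F \<in> borel_measurable M"
    and L0_Sup_upper: "f \<in> F \<Longrightarrow> AE w in M. f w \<le> L0_Sup M F w"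
    and L0_Sup_least: "\<lbrakk>t \<in> borel_measurable M; \<And>f. f \<in> F \<Longrightarrow> AE w in M. f w \<le> t w\<rbrakk>
      \<Longrightarrow> AE w in M. L0_Sup M F w \<le> t w"
proof -
  obtain C where C: "C \<subseteq> F" "countable C" "\<And>f. f \<in> F \<Longrightarrow> AE w in M. f w \<le> (SUP c\<in>C. c w)"
    using countable_essential_Sup[OF F] by blast
  let ?P = "\<lambda>s. s \<in> borel_measurable M \<and> (\<forall>f\<in>F. AE w in M. f w \<le> s w) \<and>
    (\<forall>t\<in>borel_measurable M. (\<forall>f\<in>F. AE w in M. f w \<le> t w) \<longrightarrow> (AE w in M. s w \<le> t w))"
  have "?P (\<lambda>w. SUP c\<in>C. c w)"
  proof (intro conjI ballI impI)
    show "(\<lambda>w. SUP c\<in>C. c w) \<in> borel_measurable M"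
      using C F by (intro borel_measurable_SUP) auto
    fix t assume "\<forall>f\<in>F. AE w in M. f w \<le> t w"
    then have "AE w in M. \<forall>c\<in>C. c w \<le> t w" using C by (subst AE_ball_countable) auto
    then show "AE w in M. (SUP c\<in>C. c w) \<le> t w" by eventually_elim (rule SUP_least, blast)
  qed (use C in auto)
  then have "?P (L0_Sup M F)" unfolding L0_Sup_def by (rule someI[where P = ?P])
  then show "L0_Sup M F \<in> borel_measurable M"
    "f \<in> F \<Longrightarrow> AE w in M. f w \<le> L0_Sup M F w"
    "\<lbrakk>t \<in> borel_measurable M; \<And>f. f \<in> F \<Longrightarrow> AE w in M. f w \<le> t w\<rbrakk>
      \<Longrightarrow> AE w in M. L0_Sup M F w \<le> t w" by blast+
qed

text \<open>
  The form in which essential infima are used below: the functionals of the Hahn--Banach argument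
  are real valued, and a common real lower bound keeps the infimum real.
\<close>

lemma (in prob_space) real_essential_Inf:
  fixes F :: "('a \<Rightarrow> real) set"
  assumes F: "F \<subseteq> borel_measurable M" "F \<noteq> {}"
    and b: "b \<in> borel_measurable M" "\<And>f. f \<in> F \<Longrightarrow> AE w in M. b w \<le> f w"
  obtains s where "s \<in> borel_measurable M" "\<And>f. f \<in> F \<Longrightarrow> AE w in M. s w \<le> f w"
    "\<And>t. \<lbrakk>t \<in> borel_measurable M; \<And>f. f \<in> F \<Longrightarrow> AE w in M. t w \<le> f w\<rbrakk> \<Longrightarrow> AE w in M. t w \<le> s w"
proof -
  define F' where "F' = (\<lambda>f w. ereal (- f w)) ` F"
  have F': "F' \<subseteq> borel_measurable M" using F by (auto simp: F'_def)
  define S where "S = L0_Sup M F'"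
  have S[measurable]: "S \<in> borel_measurable M" unfolding S_def by (rule L0_Sup_measurable[OF F'])
  have up: "AE w in M. ereal (- f w) \<le> S w" if "f \<in> F" for f
    using L0_Sup_upper[OF F', of "\<lambda>w. ereal (- f w)"] that by (auto simp: S_def F'_def)
  have least: "AE w in M. S w \<le> ereal (- t w)"
    if [measurable]: "t \<in> borel_measurable M" and t: "\<And>f. f \<in> F \<Longrightarrow> AE w in M. t w \<le> f w" for t
    unfolding S_def
  proof (rule L0_Sup_least[OF F'])
    fix g assume "g \<in> F'"
    then obtain f where f: "f \<in> F" "g = (\<lambda>w. ereal (- f w))" by (auto simp: F'_def)
    show "AE w in M. g w \<le> ereal (- t w)" using t[OF f(1)] by eventually_elim (simp add: f(2))
  qed measurable
  obtain f0 where f0: "f0 \<in> F" using F by auto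
  have lb: "AE w in M. S w \<le> ereal (- b w)" by (rule least) (use b in auto)
  have fin: "AE w in M. \<bar>S w\<bar> \<noteq> \<infinity>"
    using up[OF f0] lb by eventually_elim auto
  show ?thesis
  proof (rule that[of "\<lambda>w. - real_of_ereal (S w)"])
    show "(\<lambda>w. - real_of_ereal (S w)) \<in> borel_measurable M" by measurable
    show "AE w in M. - real_of_ereal (S w) \<le> f w" if "f \<in> F" for f
      using up[OF that] fin
    proof eventually_elim
      case (elim w) then show ?case by (cases "S w") auto
    qed
    show "AE w in M. t w \<le> - real_of_ereal (S w)"
      if t: "t \<in> borel_measurable M" "\<And>f. f \<in> F \<Longrightarrow> AE w in M. t w \<le> f w" for t
    proof -
      have "AE w in M. S w \<le> ereal (- t w)" by (rule least) (use t in auto)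
      with fin show ?thesis
      proof eventually_elim
        case (elim w) then show ?case by (cases "S w") auto
      qed
    qed
  qed
qed

text \<open>
  Let \<open>A\<close> be the set where the essential supremum is infinite.  In general no single member
  exceeds \<open>c\<close> on all of \<open>A\<close> up to a null set, but the part of \<open>A\<close> where it fails can be made as small
  as wanted: the sets where the first \<open>n\<close> members of a countable dominating family all stay below \<open>c\<close>
  decrease to the empty set, and a directed family has a member above these \<open>n\<close>.  Accepting a small
  exceptional set replaces the pasting of infinitely many elements.
\<close>

lemma (in prob_space) unbounded_escape:
  fixes \<Phi> :: "'e \<Rightarrow> 'a \<Rightarrow> real"
  assumes G: "G \<noteq> {}"
    and meas: "\<And>g. g \<in> G \<Longrightarrow> \<Phi> g \<in> borel_measurable M"
    and dir: "\<And>x y. \<lbrakk>x \<in> G; y \<in> G\<rbrakk> \<Longrightarrow> \<exists>z\<in>G. AE w in M. \<Phi> x w \<le> \<Phi> z w \<and> \<Phi> y w \<le> \<Phi> z w"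
    and unb: "\<not> (\<exists>b\<in>borel_measurable M. \<forall>g\<in>G. AE w in M. \<Phi> g w \<le> b w)"
  obtains A where "A \<in> events" "0 < prob A"
    "\<And>c \<epsilon>. \<lbrakk>c \<in> borel_measurable M; 0 < \<epsilon>\<rbrakk> \<Longrightarrow> \<exists>g\<in>G. prob {w \<in> A. \<Phi> g w \<le> c w} < \<epsilon>"
proof -
  define F where "F = (\<lambda>g w. ereal (\<Phi> g w)) ` G"
  have F: "F \<subseteq> borel_measurable M" using meas by (auto simp: F_def)
  obtain C where C: "C \<subseteq> F" "countable C" "\<And>f. f \<in> F \<Longrightarrow> AE w in M. f w \<le> (SUP c\<in>C. c w)"
    using countable_essential_Sup[OF F] by blast
  obtain g0 where g0: "g0 \<in> G" using G by auto
  obtain C' where C': "C' \<subseteq> G" "countable C'" "C = (\<lambda>g w. ereal (\<Phi> g w)) ` C'"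
    using C(1,2) unfolding F_def by (metis countable_subset_image)
  define I where "I = insert g0 C'"
  have I: "I \<subseteq> G" "countable I" "I \<noteq> {}" using g0 C' by (auto simp: I_def)
  define e where "e = from_nat_into I"
  have rI: "range e = I" unfolding e_def using I by simp
  have eG: "e n \<in> G" for n using rI I(1) by auto
  note [measurable] = meas[OF eG]
  define S where "S w = (SUP n. ereal (\<Phi> (e n) w))" for w
  have Sm[measurable]: "S \<in> borel_measurable M" unfolding S_def by measurable
  have up: "AE w in M. ereal (\<Phi> g w) \<le> S w" if "g \<in> G" for g
  proof -
    have "AE w in M. ereal (\<Phi> g w) \<le> (SUP c\<in>C. c w)" using C(3) that by (auto simp: F_def)
    then show ?thesis
    proof eventually_elim
      case (elim w)
      have "(SUP c\<in>C. c w) \<le> S w"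
      proof (rule SUP_least)
        fix c assume "c \<in> C"
        then obtain n where "c = (\<lambda>w. ereal (\<Phi> (e n) w))" using C'(3) rI unfolding I_def by (auto) (metis insertI2 rangeE)
        then show "c w \<le> S w" unfolding S_def by (auto intro: SUP_upper)
      qed
      with elim show ?case by simp
    qed
  qed
  have dirn: "\<exists>z\<in>G. AE w in M. \<forall>i\<le>n. \<Phi> (e i) w \<le> \<Phi> z w" for n
  proof (induction n)
    case 0 show ?case using eG[of 0] by (intro bexI[of _ "e 0"]) auto
  next
    case (Suc n)
    then obtain z where z: "z \<in> G" "AE w in M. \<forall>i\<le>n. \<Phi> (e i) w \<le> \<Phi> z w" by blast
    obtain z' where z': "z' \<in> G" "AE w in M. \<Phi> z w \<le> \<Phi> z' w \<and> \<Phi> (e (Suc n)) w \<le> \<Phi> z' w"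
      using dir[OF z(1) eG] by blast
    have "AE w in M. \<forall>i\<le>Suc n. \<Phi> (e i) w \<le> \<Phi> z' w"
      using z(2) z'(2) by eventually_elim (auto simp: le_Suc_eq intro: order_trans)
    with z'(1) show ?case by blast
  qed
  \<comment> \<open>If this set were null, the finite supremum would be a bound.\<close>
  define A where "A = {w \<in> space M. S w = \<infinity>}"
  have A[measurable]: "A \<in> events" unfolding A_def by measurable
  have pA: "0 < prob A"
  proof (rule ccontr)
    assume "\<not> ?thesis"
    then have "prob A = 0" using measure_nonneg[of M A] by linarith
    then have "AE w in M. w \<notin> A" by (simp add: prob_eq_0)
    then have "AE w in M. S w < \<infinity>" using AE_space by eventually_elim (auto simp: A_def)
    then have *: "AE w in M. \<Phi> g w \<le> real_of_ereal (S w)" if "g \<in> G" for g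
      using up[OF that]
    proof eventually_elim
      case (elim w) then show ?case by (cases "S w") auto
    qed
    have "(\<lambda>w. real_of_ereal (S w)) \<in> borel_measurable M" by measurable
    then have "\<exists>b\<in>borel_measurable M. \<forall>g\<in>G. AE w in M. \<Phi> g w \<le> b w"
      by (rule bexI[rotated]) (intro ballI *)
    with unb show False by simp
  qed
  have "\<exists>g\<in>G. prob {w \<in> A. \<Phi> g w \<le> c w} < \<epsilon>"
    if [measurable]: "c \<in> borel_measurable M" and "0 < \<epsilon>" for c \<epsilon>
  proof -
    define N where "N n = {w \<in> space M. w \<in> A \<and> (\<forall>i\<le>n. \<Phi> (e i) w \<le> c w)}" for n
    have Nm: "N n \<in> events" for n unfolding N_def by measurable
    have "(\<Inter>n. N n) = {}"
    proof safe
      fix w assume w: "w \<in> (\<Inter>n. N n)"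
      then have "\<Phi> (e n) w \<le> c w" for n by (auto simp: N_def)
      then have "S w \<le> ereal (c w)" unfolding S_def by (auto intro: SUP_least)
      moreover have "S w = \<infinity>" using w by (auto simp: N_def A_def)
      ultimately show "w \<in> {}" by simp
    qed
    moreover have "(\<lambda>n. prob (N n)) \<longlonglongrightarrow> prob (\<Inter>n. N n)"
      using Nm by (intro finite_Lim_measure_decseq) (auto simp: N_def decseq_def)
    ultimately have "(\<lambda>n. prob (N n)) \<longlonglongrightarrow> 0" by simp
    then have "\<forall>\<^sub>F n in sequentially. prob (N n) < \<epsilon>" using \<open>0 < \<epsilon>\<close> by (rule order_tendstoD)
    then obtain n where n: "prob (N n) < \<epsilon>" by (auto simp: eventually_sequentially)
    obtain z where z: "z \<in> G" "AE w in M. \<forall>i\<le>n. \<Phi> (e i) w \<le> \<Phi> z w" using dirn by blast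
    have "prob {w \<in> A. \<Phi> z w \<le> c w} \<le> prob (N n)"
    proof (intro finite_measure_mono_AE Nm)
      show "AE w in M. w \<in> {w \<in> A. \<Phi> z w \<le> c w} \<longrightarrow> w \<in> N n"
        using z(2) AE_space by eventually_elim (auto simp: N_def intro: order_trans)
    qed
    then show ?thesis using n z(1) by (intro bexI[of _ z]) linarith+
  qed
  with A pA that show ?thesis by blast
qed

text \<open>
  The exceptional sets of \<open>unbounded_escape\<close> for a sequence of bounds are removed all at once; a
  geometric choice of their sizes removes at most half of \<open>A\<close>.
\<close>

lemma (in prob_space) nonnull_remainder:
  assumes A: "A \<in> events" "0 < prob A"
    and N: "\<And>k::nat. N k \<in> events" "\<And>k. prob (N k) < prob A / 2 ^ (k + 2)"
  shows "A - (\<Union>k. N k) \<in> events" "0 < prob (A - (\<Union>k. N k))"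
proof -
  have s: "(\<lambda>k. prob A / 2 ^ (k + 2)) sums (prob A / 2)"
    using sums_mult[OF power_half_series, of "prob A / 2"] by (simp add: field_simps power_divide)
  have sN: "summable (\<lambda>k. prob (N k))"
    by (rule summable_comparison_test'[OF sums_summable[OF s], of 0]) (use N(2) in \<open>auto intro: less_imp_le\<close>)
  have "prob (\<Union>k. N k) \<le> (\<Sum>k. prob (N k))"
    using N(1) sN by (intro finite_measure_subadditive_countably) auto
  also have "\<dots> \<le> (\<Sum>k. prob A / 2 ^ (k + 2))"
    by (intro suminf_le sN sums_summable[OF s]) (use N(2) in \<open>auto intro: less_imp_le\<close>)
  also have "\<dots> = prob A / 2" using s by (simp add: sums_iff)
  finally have u: "prob (\<Union>k. N k) \<le> prob A / 2" .
  have U: "(\<Union>k. N k) \<in> events" using N(1) by auto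
  show "A - (\<Union>k. N k) \<in> events" using A(1) U by auto
  have "prob A \<le> prob ((A - (\<Union>k. N k)) \<union> (\<Union>k. N k))"
    using A(1) U by (intro finite_measure_mono) auto
  also have "\<dots> \<le> prob (A - (\<Union>k. N k)) + prob (\<Union>k. N k)"
    using A(1) U by (intro measure_Un_le) auto
  finally show "0 < prob (A - (\<Union>k. N k))" using u A(2) by linarith
qed

section \<open>Arithmetic in random normed modules\<close>

context rn_module
begin

lemmas nrm_borel [measurable] = nrm_measurable

text \<open>
  Only real-valued scalars are ever applied to elements of the module, so this restriction of
  the scalar multiplication makes the argument independent of the scalar field.
\<close>

definition rsmul :: "('w \<Rightarrow> real) \<Rightarrow> 'e \<Rightarrow> 'e"
  where "rsmul \<xi> x = smul (\<lambda>w. of_real (\<xi> w)) x"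

definition rcomb :: "('w \<Rightarrow> real) \<Rightarrow> 'e \<Rightarrow> 'e \<Rightarrow> 'e"
  where "rcomb \<xi> x y = rsmul \<xi> x + rsmul (\<lambda>w. 1 - \<xi> w) y"

lemma rsmul_add_right:
  assumes [measurable]: "\<xi> \<in> borel_measurable M"
  shows "rsmul \<xi> (x + y) = rsmul \<xi> x + rsmul \<xi> y"
  unfolding rsmul_def by (intro smul_add_right) measurable

lemma rsmul_add_left:
  assumes [measurable]: "\<xi> \<in> borel_measurable M" "\<eta> \<in> borel_measurable M"
  shows "rsmul (\<lambda>w. \<xi> w + \<eta> w) x = rsmul \<xi> x + rsmul \<eta> x"
  unfolding rsmul_def of_real_add by (intro smul_add_left) measurable

lemma rsmul_rsmul:
  assumes [measurable]: "\<xi> \<in> borel_measurable M" "\<eta> \<in> borel_measurable M"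
  shows "rsmul \<xi> (rsmul \<eta> x) = rsmul (\<lambda>w. \<xi> w * \<eta> w) x"
  unfolding rsmul_def of_real_mult by (intro smul_smul) measurable

lemma rsmul_one: "rsmul (\<lambda>_. 1) x = x"
  by (simp add: rsmul_def smul_one)

lemma rsmul_zero_right: "\<xi> \<in> borel_measurable M \<Longrightarrow> rsmul \<xi> 0 = 0"
  using rsmul_add_right[of \<xi> 0 0] by simp

lemma rsmul_zero_left: "rsmul (\<lambda>_. 0) x = 0"
  using rsmul_add_left[of "\<lambda>_. 0" "\<lambda>_. 0" x] by simp

lemma rsmul_minus_right:
  assumes "\<xi> \<in> borel_measurable M" shows "rsmul \<xi> (- x) = - rsmul \<xi> x"
  using rsmul_add_right[OF assms, of x "- x"] rsmul_zero_right[OF assms]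
  by (simp add: eq_neg_iff_add_eq_0 add.commute)

lemma rsmul_minus_one: "rsmul (\<lambda>_. - 1) x = - x"
  using rsmul_add_left[of "\<lambda>_. 1" "\<lambda>_. - 1" x]
  by (simp add: rsmul_one rsmul_zero_left eq_neg_iff_add_eq_0 add.commute)

lemma nrm_rsmul:
  assumes [measurable]: "\<xi> \<in> borel_measurable M"
  shows "AE w in M. nrm (rsmul \<xi> x) w = \<bar>\<xi> w\<bar> * nrm x w"
proof -
  have "AE w in M. nrm (rsmul \<xi> x) w = norm (of_real (\<xi> w) :: 'k) * nrm x w"
    unfolding rsmul_def by (intro nrm_smul) measurable
  then show ?thesis by simp
qed

lemma nrm_zero: "AE w in M. nrm 0 w = 0"
  using nrm_rsmul[of "\<lambda>_. 0" 0] by (simp add: rsmul_zero_left)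

lemma nrm_minus: "AE w in M. nrm (- x) w = nrm x w"
  using nrm_rsmul[of "\<lambda>_. - 1" x] by (simp add: rsmul_minus_one)

lemma nrm_minus_commute: "AE w in M. nrm (x - y) w = nrm (y - x) w"
  using nrm_minus[of "y - x"] by simp

lemma rcomb_minus:
  assumes [measurable]: "\<xi> \<in> borel_measurable M"
  shows "- rcomb \<xi> x y = rcomb \<xi> (- x) (- y)"
  by (simp add: rcomb_def rsmul_minus_right)

lemma rcomb_self:
  assumes [measurable]: "\<xi> \<in> borel_measurable M"
  shows "rcomb \<xi> x x = x"
  using rsmul_add_left[of \<xi> "\<lambda>w. 1 - \<xi> w" x] by (simp add: rcomb_def rsmul_one)

lemma rcomb_diff:
  assumes [measurable]: "\<xi> \<in> borel_measurable M"
  shows "rcomb \<xi> x y - z = rcomb \<xi> (x - z) (y - z)"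
proof -
  have "rcomb \<xi> (x - z) (y - z) + rcomb \<xi> z z = rcomb \<xi> x y"
    using rsmul_add_right[of \<xi> "x - z" z] rsmul_add_right[of "\<lambda>w. 1 - \<xi> w" "y - z" z]
    by (simp add: rcomb_def algebra_simps)
  then show ?thesis unfolding rcomb_self[OF assms] by (metis add_diff_cancel)
qed

lemma rsmul_glue:
  assumes [measurable]: "\<xi> \<in> borel_measurable M" and \<xi>: "\<And>w. \<xi> w = 0 \<or> \<xi> w = 1"
  shows "rsmul \<xi> (rcomb \<xi> x y) = rsmul \<xi> x"
    and "rsmul (\<lambda>w. 1 - \<xi> w) (rcomb \<xi> x y) = rsmul (\<lambda>w. 1 - \<xi> w) y"
proof -
  have *: "(\<lambda>w. \<xi> w * \<xi> w) = \<xi>" "(\<lambda>w. \<xi> w * (1 - \<xi> w)) = (\<lambda>_. 0)"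
    "(\<lambda>w. (1 - \<xi> w) * \<xi> w) = (\<lambda>_. 0)" "(\<lambda>w. (1 - \<xi> w) * (1 - \<xi> w)) = (\<lambda>w. 1 - \<xi> w)"
    using \<xi> by (auto intro!: ext) (metis diff_self mult_zero_left mult_zero_right diff_zero mult_1)+
  show "rsmul \<xi> (rcomb \<xi> x y) = rsmul \<xi> x"
    "rsmul (\<lambda>w. 1 - \<xi> w) (rcomb \<xi> x y) = rsmul (\<lambda>w. 1 - \<xi> w) y"
    by (simp_all add: rcomb_def rsmul_add_right rsmul_rsmul * rsmul_zero_left)
qed

text \<open>
  Convex combinations with a coefficient in \<open>{0, 1}\<close> paste two elements along an event.  This is the
  source of all directedness arguments below: pasting along the event where one of two random
  quantities is the larger one gives the pointwise maximum, or the minimum.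
\<close>

lemma nrm_glue:
  assumes [measurable]: "\<xi> \<in> borel_measurable M" and \<xi>: "\<And>w. \<xi> w = 0 \<or> \<xi> w = 1"
  shows "AE w in M. nrm (rcomb \<xi> x y) w = (if \<xi> w = 1 then nrm x w else nrm y w)"
proof -
  have m: "(\<lambda>w. 1 - \<xi> w) \<in> borel_measurable M" by measurable
  show ?thesis
    using nrm_rsmul[OF assms(1), of "rcomb \<xi> x y"] nrm_rsmul[OF assms(1), of x]
      nrm_rsmul[OF m, of "rcomb \<xi> x y"] nrm_rsmul[OF m, of y]
    unfolding rsmul_glue[OF assms]
    by eventually_elim (use \<xi> in force)
qed

lemma nrm_rcomb_le:
  assumes [measurable]: "\<xi> \<in> borel_measurable M" and \<xi>: "AE w in M. 0 \<le> \<xi> w \<and> \<xi> w \<le> 1"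
  shows "AE w in M. nrm (rcomb \<xi> x y) w \<le> \<xi> w * nrm x w + (1 - \<xi> w) * nrm y w"
proof -
  have "AE w in M. nrm (rsmul (\<lambda>w. 1 - \<xi> w) y) w = \<bar>1 - \<xi> w\<bar> * nrm y w" by (rule nrm_rsmul) measurable
  moreover have "AE w in M. nrm (rcomb \<xi> x y) w \<le> nrm (rsmul \<xi> x) w + nrm (rsmul (\<lambda>w. 1 - \<xi> w) y) w"
    unfolding rcomb_def by (rule nrm_triangle)
  ultimately show ?thesis using nrm_rsmul[OF assms(1), of x] \<xi> by eventually_elim auto
qed

lemma L0_convex_iff:
  "L0_convex M smul G \<longleftrightarrow> (\<forall>x\<in>G. \<forall>y\<in>G. \<forall>\<xi>. \<xi> \<in> borel_measurable M \<and>
    (AE w in M. 0 \<le> \<xi> w \<and> \<xi> w \<le> 1) \<longrightarrow> rcomb \<xi> x y \<in> G)"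
  by (simp add: L0_convex_def rcomb_def rsmul_def)

lemma L0_convexI:
  assumes "\<And>x y \<xi>. \<lbrakk>x \<in> G; y \<in> G; \<xi> \<in> borel_measurable M; AE w in M. 0 \<le> \<xi> w \<and> \<xi> w \<le> 1\<rbrakk>
    \<Longrightarrow> rcomb \<xi> x y \<in> G"
  shows "L0_convex M smul G"
  using assms by (auto simp: L0_convex_iff)

lemma L0_convexD:
  assumes "L0_convex M smul G" "x \<in> G" "y \<in> G" "\<xi> \<in> borel_measurable M"
    "AE w in M. 0 \<le> \<xi> w \<and> \<xi> w \<le> 1"
  shows "rcomb \<xi> x y \<in> G"
  using assms by (auto simp: L0_convex_iff)

lemma L0_convex_Inter: "(\<And>A. A \<in> \<A> \<Longrightarrow> L0_convex M smul A) \<Longrightarrow> L0_convex M smul (\<Inter>\<A>)"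
  by (auto simp: L0_convex_iff)

section \<open>Closed sublevel sets\<close>

lemma topspace_el: "topspace (el_topology M nrm) = UNIV"
proof -
  have "openin (el_topology M nrm) UNIV"
    unfolding openin_el_topology by (auto intro!: exI[of _ "1::real"] exI[of _ "1/2::real"])
  then show ?thesis using openin_subset by blast
qed

text \<open>
  If \<open>\<phi> x\<close> exceeds \<open>\<epsilon>\<close> on a set of probability \<open>q > 0\<close>, then every \<open>y\<close> with
  \<open>nrm (y - x) < \<epsilon>\<close> outside a set of probability less than \<open>q / 2\<close> still has \<open>\<phi> y > 0\<close> on a set
  of positive probability.  All closedness proofs below reduce to this one.
\<close>

lemma closedin_sublevel:
  fixes \<phi> :: "'e \<Rightarrow> 'w \<Rightarrow> real"
  assumes [measurable]: "\<And>x. \<phi> x \<in> borel_measurable M"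
    and lip: "\<And>x y. AE w in M. \<phi> x w \<le> \<phi> y w + nrm (y - x) w"
  shows "closedin (el_topology M nrm) {x. AE w in M. \<phi> x w \<le> 0}"
proof -
  have "\<exists>\<epsilon>>0. \<exists>l. 0 < l \<and> l < 1 \<and> el_ball M nrm x \<epsilon> l \<subseteq> - {x. AE w in M. \<phi> x w \<le> 0}"
    if x: "\<not> (AE w in M. \<phi> x w \<le> 0)" for x
  proof -
    have "\<not> (AE w in M. \<forall>n::nat. \<phi> x w \<le> 1 / Suc n)"
    proof
      assume "AE w in M. \<forall>n::nat. \<phi> x w \<le> 1 / Suc n"
      then have "AE w in M. \<phi> x w \<le> 0"
        by eventually_elim (metis nat_approx_posE not_le)
      with x show False by simp
    qed
    then obtain n :: nat where n: "\<not> (AE w in M. \<phi> x w \<le> 1 / Suc n)"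
      unfolding AE_all_countable by blast
    define \<epsilon> where "\<epsilon> = 1 / real (Suc n)"
    have "\<epsilon> > 0" by (simp add: \<epsilon>_def)
    define Q where "Q = {w \<in> space M. \<epsilon> < \<phi> x w}"
    have Q[measurable]: "Q \<in> events" unfolding Q_def by measurable
    have "prob Q \<noteq> 0"
    proof
      assume "prob Q = 0"
      then have "AE w in M. w \<notin> Q" by (simp add: prob_eq_0)
      with AE_space have "AE w in M. \<phi> x w \<le> \<epsilon>" by eventually_elim (auto simp: Q_def)
      with n show False by (simp add: \<epsilon>_def)
    qed
    then have pQ: "prob Q > 0" using measure_nonneg[of M Q] by linarith
    have "el_ball M nrm x \<epsilon> (prob Q / 2) \<subseteq> - {x. AE w in M. \<phi> x w \<le> 0}"
    proof
      fix y assume y: "y \<in> el_ball M nrm x \<epsilon> (prob Q / 2)"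
      define R where "R = {w \<in> space M. nrm (y - x) w < \<epsilon>}"
      have R[measurable]: "R \<in> events" unfolding R_def by measurable
      have pR: "prob R > 1 - prob Q / 2" using y by (simp add: el_ball_def R_def)
      show "y \<in> - {x. AE w in M. \<phi> x w \<le> 0}"
      proof
        assume "y \<in> {x. AE w in M. \<phi> x w \<le> 0}"
        then have "AE w in M. \<phi> y w \<le> 0" by simp
        then have "AE w in M. w \<notin> Q \<inter> R"
          using lip[of x y] by eventually_elim (auto simp: Q_def R_def)
        then have "prob (Q \<inter> R) = 0" by (simp add: prob_eq_0)
        moreover have "prob (Q \<union> R) \<le> 1" by simp
        moreover have "prob (Q \<union> R) = prob Q + prob R - prob (Q \<inter> R)"
          by (simp add: measure_Un3 emeasure_eq_measure fmeasurable_eq_sets)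
        ultimately show False using pR pQ by linarith
      qed
    qed
    moreover have "prob Q / 2 < 1" using prob_le_1[of Q] by linarith
    ultimately show ?thesis using \<open>\<epsilon> > 0\<close> pQ by (intro exI[of _ \<epsilon>] conjI exI[of _ "prob Q / 2"]) auto
  qed
  then show ?thesis
    unfolding closedin_def topspace_el openin_el_topology by (auto simp: Compl_eq_Diff_UNIV)
qed

section \<open>A random Hahn--Banach theorem\<close>

text \<open>
  The bound by the norm is part of the definition because all functionals below are constructed
  under it; together with subadditivity it gives the lower bound that essential infima require.
\<close>

definition L0_sublinear :: "('e \<Rightarrow> 'w \<Rightarrow> real) \<Rightarrow> bool"
  where "L0_sublinear p \<longleftrightarrow>
    (\<forall>x. p x \<in> borel_measurable M) \<and>
    (\<forall>x y. AE w in M. p (x + y) w \<le> p x w + p y w) \<and>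
    (\<forall>\<xi> x. \<xi> \<in> borel_measurable M \<and> (AE w in M. 0 \<le> \<xi> w) \<longrightarrow>
      (AE w in M. p (rsmul \<xi> x) w \<le> \<xi> w * p x w)) \<and>
    (\<forall>x. AE w in M. p x w \<le> nrm x w)"

lemma
  assumes "L0_sublinear p"
  shows L0_sublinear_measurable: "p x \<in> borel_measurable M"
    and L0_sublinear_add: "AE w in M. p (x + y) w \<le> p x w + p y w"
    and L0_sublinear_rsmul: "\<lbrakk>\<xi> \<in> borel_measurable M; AE w in M. 0 \<le> \<xi> w\<rbrakk> \<Longrightarrow>
      AE w in M. p (rsmul \<xi> x) w \<le> \<xi> w * p x w"
    and L0_sublinear_le_nrm: "AE w in M. p x w \<le> nrm x w"
  using assms by (auto simp: L0_sublinear_def)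

lemma L0_sublinear_minus:
  assumes p: "L0_sublinear p"
  shows "AE w in M. 0 \<le> p x w + p (- x) w"
  using L0_sublinear_add[OF p, of 0 0] L0_sublinear_add[OF p, of x "- x"]
  by eventually_elim simp

lemma L0_sublinear_ge_nrm:
  assumes p: "L0_sublinear p"
  shows "AE w in M. - nrm x w \<le> p x w"
  using L0_sublinear_minus[OF p, of x] L0_sublinear_le_nrm[OF p, of "- x"] nrm_minus[of x]
  by eventually_elim simp

text \<open>
  Homogeneity holds with equality: where \<open>\<xi>\<close> is positive one multiplies by its inverse, and where
  it vanishes both signs of \<open>x\<close> give nonpositive values whose sum is nonnegative.
\<close>

lemma L0_sublinear_rsmul_ge:
  assumes p: "L0_sublinear p" and \<xi>m[measurable]: "\<xi> \<in> borel_measurable M" and \<xi>: "AE w in M. 0 \<le> \<xi> w"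
  shows "AE w in M. \<xi> w * p x w \<le> p (rsmul \<xi> x) w"
proof -
  define i :: "'w \<Rightarrow> real" where "i w = (if 0 < \<xi> w then 1 else 0)" for w
  define \<eta> where "\<eta> w = (if 0 < \<xi> w then inverse (\<xi> w) else 0)" for w
  have im: "i \<in> borel_measurable M" "(\<lambda>w. 1 - i w) \<in> borel_measurable M" and \<eta>m: "\<eta> \<in> borel_measurable M"
    unfolding i_def[abs_def] \<eta>_def[abs_def] by measurable
  have "rsmul (\<lambda>w. i w + (1 - i w)) x = rsmul i x + rsmul (\<lambda>w. 1 - i w) x"
    by (rule rsmul_add_left[OF im])
  then have split: "x = rsmul i x + rsmul (\<lambda>w. 1 - i w) x" by (simp add: rsmul_one)
  have "(\<lambda>w. \<eta> w * \<xi> w) = i" by (auto simp: \<eta>_def i_def)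
  then have "rsmul i x = rsmul \<eta> (rsmul \<xi> x)" using rsmul_rsmul[OF \<eta>m \<xi>m] by simp
  moreover have "AE w in M. p (rsmul \<eta> (rsmul \<xi> x)) w \<le> \<eta> w * p (rsmul \<xi> x) w"
    by (rule L0_sublinear_rsmul[OF p \<eta>m]) (simp add: \<eta>_def)
  ultimately have 1: "AE w in M. p (rsmul i x) w \<le> \<eta> w * p (rsmul \<xi> x) w" by simp
  have 2: "AE w in M. p (rsmul (\<lambda>w. 1 - i w) x) w \<le> (1 - i w) * p x w"
    by (rule L0_sublinear_rsmul[OF p im(2)]) (simp add: i_def)
  have 3: "AE w in M. p x w \<le> p (rsmul i x) w + p (rsmul (\<lambda>w. 1 - i w) x) w"
    using L0_sublinear_add[OF p, of "rsmul i x" "rsmul (\<lambda>w. 1 - i w) x"] split by simp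
  have 4: "AE w in M. p (- rsmul \<xi> x) w \<le> \<xi> w * p (- x) w"
    using L0_sublinear_rsmul[OF p \<xi>m \<xi>, of "- x"] by (simp add: rsmul_minus_right)
  show ?thesis
    using 1 2 3 4 \<xi> L0_sublinear_minus[OF p, of "rsmul \<xi> x"]
  proof eventually_elim
    case (elim w)
    show ?case
    proof (cases "0 < \<xi> w")
      case True
      then have "p x w \<le> inverse (\<xi> w) * p (rsmul \<xi> x) w" using elim by (simp add: i_def \<eta>_def)
      with True show ?thesis by (simp add: field_simps)
    next
      case False
      with elim show ?thesis by simp
    qed
  qed
qed

lemma L0_sublinear_nrm: "L0_sublinear nrm"
  unfolding L0_sublinear_def
proof (intro conjI allI impI)
  fix \<xi> :: "'w \<Rightarrow> real" and x
  assume "\<xi> \<in> borel_measurable M \<and> (AE w in M. 0 \<le> \<xi> w)"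
  then have "\<xi> \<in> borel_measurable M" "AE w in M. 0 \<le> \<xi> w" by auto
  with nrm_rsmul[of \<xi> x] show "AE w in M. nrm (rsmul \<xi> x) w \<le> \<xi> w * nrm x w"
    by (auto elim: eventually_elim2)
qed (simp_all add: nrm_measurable nrm_triangle)

text \<open>
  Pointwise essential infima preserve sublinearity as soon as the defining inequalities can be
  realised by suitable members of the family.  This serves both for the infimum of a chain
  and for the infimum over translates along a direction.
\<close>

lemma L0_sublinear_Inf:
  assumes I: "i0 \<in> I"
    and [measurable]: "\<And>i x. h i x \<in> borel_measurable M"
    and lower: "\<And>i x. i \<in> I \<Longrightarrow> AE w in M. - nrm x w \<le> h i x w"
    and upper: "\<And>x. AE w in M. h i0 x w \<le> nrm x w"
    and add: "\<And>i j x y. \<lbrakk>i \<in> I; j \<in> I\<rbrakk> \<Longrightarrow> \<exists>k\<in>I. AE w in M. h k (x + y) w \<le> h i x w + h j y w"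
    and scale: "\<And>i \<xi> x. \<lbrakk>i \<in> I; \<xi> \<in> borel_measurable M; AE w in M. 0 \<le> \<xi> w\<rbrakk>
      \<Longrightarrow> \<exists>k\<in>I. AE w in M. h k (rsmul \<xi> x) w \<le> \<xi> w * h i x w"
  obtains p where "L0_sublinear p" "\<And>i x. i \<in> I \<Longrightarrow> AE w in M. p x w \<le> h i x w"
proof -
  let ?Q = "\<lambda>x s. s \<in> borel_measurable M \<and> (\<forall>i\<in>I. AE w in M. s w \<le> h i x w) \<and>
    (\<forall>t\<in>borel_measurable M. (\<forall>i\<in>I. AE w in M. t w \<le> h i x w) \<longrightarrow> (AE w in M. t w \<le> s w))"
  have "\<exists>s. ?Q x s" for x
  proof (rule real_essential_Inf[of "(\<lambda>i. h i x) ` I" "\<lambda>w. - nrm x w"])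
    fix s assume s: "s \<in> borel_measurable M" "\<And>f. f \<in> (\<lambda>i. h i x) ` I \<Longrightarrow> AE w in M. s w \<le> f w"
      and g: "\<And>t. \<lbrakk>t \<in> borel_measurable M; \<And>f. f \<in> (\<lambda>i. h i x) ` I \<Longrightarrow> AE w in M. t w \<le> f w\<rbrakk>
        \<Longrightarrow> AE w in M. t w \<le> s w"
    have "?Q x s" using s by (intro conjI ballI impI g) auto
    then show ?thesis by (rule exI[where P = "?Q x"])
  qed (use I lower in auto)
  then have "\<exists>p. \<forall>x. ?Q x (p x)" using choice[where Q = ?Q] by simp
  then obtain p where "\<forall>x. ?Q x (p x)" by (rule exE)
  then have p[measurable]: "\<And>x. p x \<in> borel_measurable M"
    and ple: "\<And>i x. i \<in> I \<Longrightarrow> AE w in M. p x w \<le> h i x w"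
    and greatest: "\<And>t x. \<lbrakk>t \<in> borel_measurable M; \<And>i. i \<in> I \<Longrightarrow> AE w in M. t w \<le> h i x w\<rbrakk>
      \<Longrightarrow> AE w in M. t w \<le> p x w"
    by blast+
  have padd: "AE w in M. p (x + y) w \<le> p x w + p y w" for x y
  proof -
    have 1: "AE w in M. p (x + y) w - h j y w \<le> p x w" if j: "j \<in> I" for j
    proof (rule greatest)
      fix i assume i: "i \<in> I"
      obtain k where k: "k \<in> I" "AE w in M. h k (x + y) w \<le> h i x w + h j y w" using add[OF i j] by blast
      show "AE w in M. p (x + y) w - h j y w \<le> h i x w"
        using ple[OF k(1), of "x + y"] k(2) by eventually_elim linarith
    qed measurable
    have "AE w in M. p (x + y) w - p x w \<le> p y w"
    proof (rule greatest)
      fix j assume "j \<in> I"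
      from 1[OF this] show "AE w in M. p (x + y) w - p x w \<le> h j y w" by eventually_elim linarith
    qed measurable
    then show ?thesis by eventually_elim linarith
  qed
  have pscale: "AE w in M. p (rsmul \<xi> x) w \<le> \<xi> w * p x w"
    if \<xi>m[measurable]: "\<xi> \<in> borel_measurable M" and \<xi>: "AE w in M. 0 \<le> \<xi> w" for \<xi> x
  proof -
    have *: "AE w in M. p (rsmul \<xi> x) w \<le> \<xi> w * h i x w" if i: "i \<in> I" for i
    proof -
      obtain k where k: "k \<in> I" "AE w in M. h k (rsmul \<xi> x) w \<le> \<xi> w * h i x w"
        using scale[OF i \<xi>m \<xi>] by blast
      show ?thesis using ple[OF k(1), of "rsmul \<xi> x"] k(2) by eventually_elim linarith
    qed
    \<comment> \<open>Where \<open>\<xi>\<close> vanishes one cannot divide by it; any common lower bound of the family will do there.\<close>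
    have "AE w in M. (if 0 < \<xi> w then p (rsmul \<xi> x) w / \<xi> w else - nrm x w) \<le> p x w"
    proof (rule greatest)
      fix i assume i: "i \<in> I"
      show "AE w in M. (if 0 < \<xi> w then p (rsmul \<xi> x) w / \<xi> w else - nrm x w) \<le> h i x w"
        using *[OF i] lower[OF i, of x] by eventually_elim (auto simp: divide_le_eq mult.commute)
    qed measurable
    then show ?thesis using \<xi> *[OF I]
    proof eventually_elim
      case (elim w)
      then show ?case by (cases "0 < \<xi> w") (auto simp: divide_le_eq mult.commute)
    qed
  qed
  have pup: "AE w in M. p x w \<le> nrm x w" for x
    using ple[OF I, of x] upper[of x] by eventually_elim linarith
  show ?thesis
    by (rule that[of p]) (use p padd pscale pup ple in \<open>auto simp: L0_sublinear_def\<close>)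
qed

text \<open>
  The smaller functional is the essential infimum of \<open>p (x + \<eta> a) - \<eta> p a\<close> over all
  nonnegative random \<open>\<eta>\<close>: \<open>\<eta> = 0\<close> shows that it lies below \<open>p\<close>, and \<open>\<eta> = 1\<close> bounds
  its value at \<open>- a\<close>.
\<close>

lemma L0_sublinear_direction:
  assumes p: "L0_sublinear p"
  obtains q where "L0_sublinear q" "\<And>x. AE w in M. q x w \<le> p x w"
    "AE w in M. q (- a) w \<le> - p a w"
proof -
  note [measurable] = L0_sublinear_measurable[OF p]
  define I where "I = {\<eta> \<in> borel_measurable M. AE w in M. (0::real) \<le> \<eta> w}"
  \<comment> \<open>The value 0 outside \<open>I\<close> makes \<open>h\<close> measurable for every index.\<close>
  define h where "h \<eta> x w = (if \<eta> \<in> I then p (x + rsmul \<eta> a) w - \<eta> w * p a w else 0)" for \<eta> x w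
  have hI: "h \<eta> x w = p (x + rsmul \<eta> a) w - \<eta> w * p a w" if "\<eta> \<in> I" for \<eta> x w
    using that by (simp add: h_def)
  have Im: "\<eta> \<in> borel_measurable M" if "\<eta> \<in> I" for \<eta> using that by (simp add: I_def)
  have I0: "(\<lambda>_. 0) \<in> I" "(\<lambda>_. 1) \<in> I" by (auto simp: I_def)
  have h0: "h (\<lambda>_. 0) x w = p x w" for x w by (simp add: hI[OF I0(1)] rsmul_zero_left)
  obtain q where q: "L0_sublinear q" "\<And>\<eta> x. \<eta> \<in> I \<Longrightarrow> AE w in M. q x w \<le> h \<eta> x w"
  proof (rule L0_sublinear_Inf[of "\<lambda>_. 0" I h])
    show "h \<eta> x \<in> borel_measurable M" for \<eta> x
    proof (cases "\<eta> \<in> I")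
      case True
      note [measurable] = Im[OF True]
      show ?thesis by (subst hI[OF True, abs_def]) measurable
    next
      case False then show ?thesis by (simp add: h_def[abs_def])
    qed
    show "AE w in M. - nrm x w \<le> h \<eta> x w" if \<eta>: "\<eta> \<in> I" for \<eta> x
    proof -
      have "AE w in M. \<eta> w * p a w \<le> p (rsmul \<eta> a) w"
        using \<eta> by (intro L0_sublinear_rsmul_ge[OF p]) (auto simp: I_def)
      moreover have "AE w in M. p (rsmul \<eta> a) w \<le> p (x + rsmul \<eta> a) w + p (- x) w"
        using L0_sublinear_add[OF p, of "x + rsmul \<eta> a" "- x"] by simp
      ultimately show ?thesis
        using L0_sublinear_le_nrm[OF p, of "- x"] nrm_minus[of x]
        unfolding hI[OF \<eta>] by eventually_elim linarith
    qed
    show "AE w in M. h (\<lambda>_. 0) x w \<le> nrm x w" for x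
      unfolding h0 by (rule L0_sublinear_le_nrm[OF p])
    show "\<exists>k\<in>I. AE w in M. h k (x + y) w \<le> h \<eta> x w + h \<zeta> y w" if "\<eta> \<in> I" "\<zeta> \<in> I" for \<eta> \<zeta> x y
    proof (rule bexI)
      note [measurable] = Im[OF that(1)] Im[OF that(2)]
      have "AE w in M. 0 \<le> \<eta> w" "AE w in M. 0 \<le> \<zeta> w" using that by (auto simp: I_def)
      then have "AE w in M. 0 \<le> \<eta> w + \<zeta> w" by eventually_elim simp
      then show k: "(\<lambda>w. \<eta> w + \<zeta> w) \<in> I" by (simp add: I_def)
      have "x + y + rsmul (\<lambda>w. \<eta> w + \<zeta> w) a = (x + rsmul \<eta> a) + (y + rsmul \<zeta> a)"
        by (subst rsmul_add_left) (auto simp: algebra_simps)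
      then show "AE w in M. h (\<lambda>w. \<eta> w + \<zeta> w) (x + y) w \<le> h \<eta> x w + h \<zeta> y w"
        unfolding hI[OF k] hI[OF that(1)] hI[OF that(2)]
        using L0_sublinear_add[OF p, of "x + rsmul \<eta> a" "y + rsmul \<zeta> a"]
        by (auto elim!: eventually_mono simp: algebra_simps)
    qed
    show "\<exists>k\<in>I. AE w in M. h k (rsmul \<xi> x) w \<le> \<xi> w * h \<eta> x w"
      if \<eta>: "\<eta> \<in> I" and [measurable]: "\<xi> \<in> borel_measurable M" and \<xi>: "AE w in M. 0 \<le> \<xi> w" for \<eta> \<xi> x
    proof (rule bexI)
      note [measurable] = Im[OF \<eta>]
      have "AE w in M. 0 \<le> \<eta> w" using \<eta> by (auto simp: I_def)
      with \<xi> have "AE w in M. 0 \<le> \<xi> w * \<eta> w" by eventually_elim simp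
      then show k: "(\<lambda>w. \<xi> w * \<eta> w) \<in> I" by (simp add: I_def)
      have "rsmul \<xi> x + rsmul (\<lambda>w. \<xi> w * \<eta> w) a = rsmul \<xi> (x + rsmul \<eta> a)"
        by (simp add: rsmul_add_right rsmul_rsmul)
      moreover have "AE w in M. p (rsmul \<xi> (x + rsmul \<eta> a)) w \<le> \<xi> w * p (x + rsmul \<eta> a) w"
        using \<xi> by (intro L0_sublinear_rsmul[OF p]) measurable
      ultimately show "AE w in M. h (\<lambda>w. \<xi> w * \<eta> w) (rsmul \<xi> x) w \<le> \<xi> w * h \<eta> x w"
        unfolding hI[OF k] hI[OF \<eta>] by (auto elim!: eventually_mono simp: algebra_simps)
    qed
  qed (use I0 in auto)
  show ?thesis
  proof (rule that[OF q(1)])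
    show "AE w in M. q x w \<le> p x w" for x using q(2)[OF I0(1), of x] by (simp add: h0)
    have "AE w in M. p 0 w \<le> 0 * p 0 w"
      using L0_sublinear_rsmul[OF p, of "\<lambda>_. 0" 0] by (simp add: rsmul_zero_left)
    then show "AE w in M. q (- a) w \<le> - p a w"
      using q(2)[OF I0(2), of "- a"] unfolding hI[OF I0(2)] by (auto simp: rsmul_one elim: eventually_elim2)
  qed
qed

text \<open>
  Oddness turns the inequalities of sublinearity into equalities, so these functionals are additive and
  homogeneous.
\<close>

definition L0_linear :: "('e \<Rightarrow> 'w \<Rightarrow> real) \<Rightarrow> bool"
  where "L0_linear f \<longleftrightarrow> L0_sublinear f \<and> (\<forall>x. AE w in M. f (- x) w = - f x w)"

lemma L0_linear_minus:
  assumes f: "L0_linear f" shows "L0_linear (\<lambda>x. f (- x))"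
proof -
  have s: "L0_sublinear f" and m: "\<And>x. AE w in M. f (- x) w = - f x w" using f by (auto simp: L0_linear_def)
  have "L0_sublinear (\<lambda>x. f (- x))"
    unfolding L0_sublinear_def
  proof (intro conjI allI impI)
    show "AE w in M. f (- (x + y)) w \<le> f (- x) w + f (- y) w" for x y
      using L0_sublinear_add[OF s, of "- x" "- y"] by (simp add: add.commute)
    show "AE w in M. f (- rsmul \<xi> x) w \<le> \<xi> w * f (- x) w"
      if "\<xi> \<in> borel_measurable M \<and> (AE w in M. 0 \<le> \<xi> w)" for \<xi> x
      using L0_sublinear_rsmul[OF s, of \<xi> "- x"] that by (simp add: rsmul_minus_right)
    show "AE w in M. f (- x) w \<le> nrm x w" for x
      using L0_sublinear_le_nrm[OF s, of "- x"] nrm_minus[of x] by eventually_elim simp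
  qed (rule L0_sublinear_measurable[OF s])
  moreover have "AE w in M. f (- (- x)) w = - f (- x) w" for x using m[of "- x"] .
  ultimately show ?thesis by (simp add: L0_linear_def)
qed

lemma L0_linear_rcomb_ge:
  assumes f: "L0_linear f" and [measurable]: "\<xi> \<in> borel_measurable M"
    and \<xi>: "AE w in M. 0 \<le> \<xi> w \<and> \<xi> w \<le> 1"
  shows "AE w in M. \<xi> w * f x w + (1 - \<xi> w) * f y w \<le> f (rcomb \<xi> x y) w"
proof -
  have s: "L0_sublinear f" and m: "\<And>x. AE w in M. f (- x) w = - f x w" using f by (auto simp: L0_linear_def)
  have "AE w in M. 0 \<le> \<xi> w" "AE w in M. 0 \<le> 1 - \<xi> w" using \<xi> by (auto elim: eventually_mono)
  then have "AE w in M. f (rsmul \<xi> (- x)) w \<le> \<xi> w * f (- x) w"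
    "AE w in M. f (rsmul (\<lambda>w. 1 - \<xi> w) (- y)) w \<le> (1 - \<xi> w) * f (- y) w"
    by (intro L0_sublinear_rsmul[OF s]; measurable)+
  moreover have "AE w in M. f (- rcomb \<xi> x y) w \<le> f (rsmul \<xi> (- x)) w + f (rsmul (\<lambda>w. 1 - \<xi> w) (- y)) w"
    unfolding rcomb_minus[OF assms(2)] unfolding rcomb_def by (rule L0_sublinear_add[OF s])
  ultimately show ?thesis
    using m[of x] m[of y] m[of "rcomb \<xi> x y"] by eventually_elim (simp add: algebra_simps)
qed

text \<open>
  Functionals that agree almost everywhere must be identified before Zorn's lemma applies.
  Passing to epigraphs does this: a functional is smaller up to null sets if and only if its
  epigraph is larger, and epigraphs are ordered by inclusion.
\<close>

lemma minimal_L0_sublinear: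
  assumes p0: "L0_sublinear p0"
  obtains p where "L0_sublinear p" "\<And>x. AE w in M. p x w \<le> p0 x w"
    "\<And>q x. \<lbrakk>L0_sublinear q; \<And>x. AE w in M. q x w \<le> p x w\<rbrakk> \<Longrightarrow> AE w in M. p x w \<le> q x w"
proof -
  define epi where "epi p = {(x, t). t \<in> borel_measurable M \<and> (AE w in M. p x w \<le> t w)}" for p :: "'e \<Rightarrow> 'w \<Rightarrow> real"
  have epiI: "epi p \<subseteq> epi q" if pq: "\<And>x. AE w in M. q x w \<le> p x w" for p q
  proof -
    have "AE w in M. q x w \<le> t w" if "AE w in M. p x w \<le> t w" for x t
      using that pq[of x] by eventually_elim linarith
    then show ?thesis unfolding epi_def by blast
  qed
  have epiD: "AE w in M. q x w \<le> p x w" if "L0_sublinear p" "epi p \<subseteq> epi q" for p q x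
  proof -
    have "(x, p x) \<in> epi p" using L0_sublinear_measurable[OF that(1)] by (auto simp: epi_def)
    then show ?thesis using that(2) by (auto simp: epi_def)
  qed
  define P where "P = {p. L0_sublinear p \<and> (\<forall>x. AE w in M. p x w \<le> p0 x w)}"
  have "\<exists>U\<in>epi ` P. \<forall>X\<in>epi ` P. U \<subseteq> X \<longrightarrow> X = U"
  proof (rule subset_Zorn)
    fix C assume C: "subset.chain (epi ` P) C"
    show "\<exists>U\<in>epi ` P. \<forall>X\<in>C. X \<subseteq> U"
    proof (cases "C = {}")
      case True
      then show ?thesis using p0 by (auto simp: P_def)
    next
      case False
      define I where "I = {p \<in> P. epi p \<in> C}"
      have IP: "p \<in> P" and Is: "L0_sublinear p" if "p \<in> I" for p using that by (auto simp: I_def P_def)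
      have "C \<subseteq> epi ` P" using C by (simp add: subset.chain_def)
      then have CI: "C = epi ` I" by (auto simp: I_def)
      with False obtain i0 where i0: "i0 \<in> I" by auto
      define h where "h p = (if p \<in> I then p else nrm)" for p
      have hs: "L0_sublinear (h p)" for p using Is by (auto simp: h_def L0_sublinear_nrm)
      obtain s where s: "L0_sublinear s" "\<And>p x. p \<in> I \<Longrightarrow> AE w in M. s x w \<le> h p x w"
      proof (rule L0_sublinear_Inf[of i0 I h])
        show "\<exists>k\<in>I. AE w in M. h k (x + y) w \<le> h p x w + h q y w" if pq: "p \<in> I" "q \<in> I" for p q x y
        proof -
          have "\<forall>X\<in>C. \<forall>Y\<in>C. X \<subseteq> Y \<or> Y \<subseteq> X" using C by (auto simp only: subset.chain_def)
          then have "epi p \<subseteq> epi q \<or> epi q \<subseteq> epi p" using pq by (simp add: I_def)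
          then have "(\<forall>x. AE w in M. q x w \<le> p x w) \<or> (\<forall>x. AE w in M. p x w \<le> q x w)"
            using epiD[OF Is[OF pq(1)], of q] epiD[OF Is[OF pq(2)], of p] by blast
          then have "\<exists>k\<in>I. (\<forall>x. AE w in M. k x w \<le> p x w) \<and> (\<forall>x. AE w in M. k x w \<le> q x w)"
          proof
            assume "\<forall>x. AE w in M. q x w \<le> p x w"
            then show ?thesis using pq(2) by (intro bexI[of _ q]) simp_all
          next
            assume "\<forall>x. AE w in M. p x w \<le> q x w"
            then show ?thesis using pq(1) by (intro bexI[of _ p]) simp_all
          qed
          then obtain k where k: "k \<in> I" "\<And>x. AE w in M. k x w \<le> p x w" "\<And>x. AE w in M. k x w \<le> q x w"
            by blast
          have "AE w in M. k (x + y) w \<le> p x w + q y w"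
            using L0_sublinear_add[OF Is[OF k(1)], of x y] k(2)[of x] k(3)[of y] by eventually_elim linarith
          then show ?thesis using k(1) pq by (auto simp: h_def)
        qed
        show "\<exists>k\<in>I. AE w in M. h k (rsmul \<xi> x) w \<le> \<xi> w * h p x w"
          if "p \<in> I" "\<xi> \<in> borel_measurable M" "AE w in M. 0 \<le> \<xi> w" for p \<xi> x
          by (rule bexI[OF L0_sublinear_rsmul[OF hs that(2,3)] that(1)])
      qed (use i0 hs in \<open>auto intro: L0_sublinear_measurable L0_sublinear_ge_nrm L0_sublinear_le_nrm\<close>)
      have sI: "AE w in M. s x w \<le> p x w" if "p \<in> I" for p x using s(2)[OF that] that by (simp add: h_def)
      have i0p: "AE w in M. i0 x w \<le> p0 x w" for x using IP[OF i0] by (simp add: P_def)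
      have "AE w in M. s x w \<le> p0 x w" for x
        using i0p[of x] sI[OF i0, of x] by eventually_elim linarith
      then have "s \<in> P" using s(1) by (simp add: P_def)
      moreover have "\<forall>X\<in>C. X \<subseteq> epi s" using epiI sI by (auto simp: CI)
      ultimately show ?thesis by blast
    qed
  qed
  then obtain p where p: "p \<in> P" and max: "\<And>q. \<lbrakk>q \<in> P; epi p \<subseteq> epi q\<rbrakk> \<Longrightarrow> epi q = epi p" by blast
  show ?thesis
  proof (rule that[of p])
    show "L0_sublinear p" "AE w in M. p x w \<le> p0 x w" for x using p by (auto simp: P_def)
    fix q x assume q: "L0_sublinear q" "\<And>x. AE w in M. q x w \<le> p x w"
    have pp0: "AE w in M. p x w \<le> p0 x w" for x using p by (simp add: P_def)
    have "AE w in M. q x w \<le> p0 x w" for x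
      using pp0[of x] q(2)[of x] by eventually_elim linarith
    then have "epi q = epi p" using q by (intro max epiI) (auto simp: P_def)
    then show "AE w in M. p x w \<le> q x w" using epiD[OF q(1)] by simp
  qed
qed

text \<open>
  Start from the norm, force the value at \<open>- a\<close> down to \<open>- nrm a\<close>, and take a minimal functional
  below the result.  A minimal functional is odd: otherwise moving in the direction \<open>x\<close> would
  give a strictly smaller one.
\<close>

theorem L0_Hahn_Banach: "\<exists>f. L0_linear f \<and> (AE w in M. nrm a w \<le> f a w)"
proof -
  obtain p0 where p0: "L0_sublinear p0" "AE w in M. p0 (- a) w \<le> - nrm a w"
    using L0_sublinear_direction[OF L0_sublinear_nrm, of a] by blast
  obtain f where f: "L0_sublinear f" "\<And>x. AE w in M. f x w \<le> p0 x w"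
    and min: "\<And>q x. \<lbrakk>L0_sublinear q; \<And>x. AE w in M. q x w \<le> f x w\<rbrakk> \<Longrightarrow> AE w in M. f x w \<le> q x w"
    using minimal_L0_sublinear[OF p0(1)] by blast
  have lin: "AE w in M. f (- x) w = - f x w" for x
  proof -
    obtain q where q: "L0_sublinear q" "\<And>y. AE w in M. q y w \<le> f y w" "AE w in M. q (- x) w \<le> - f x w"
      using L0_sublinear_direction[OF f(1), of x] by blast
    show ?thesis using min[OF q(1,2), of "- x"] q(3) L0_sublinear_minus[OF f(1), of x]
      by eventually_elim linarith
  qed
  then have "L0_linear f" using f(1) by (auto simp: L0_linear_def)
  moreover have "AE w in M. nrm a w \<le> f a w"
    using lin[of a] f(2)[of "- a"] p0(2) by eventually_elim linarith
  ultimately show ?thesis by blast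
qed

section \<open>Boundedness of convexly compact sets\<close>

lemma
  assumes f: "L0_linear f"
  shows L0_linear_measurable: "f x \<in> borel_measurable M"
    and L0_linear_uminus: "AE w in M. f (- x) w = - f x w"
    and L0_linear_abs_le: "AE w in M. \<bar>f x w\<bar> \<le> nrm x w"
    and L0_linear_lipschitz: "AE w in M. f y w \<le> f x w + nrm (y - x) w"
proof -
  have s: "L0_sublinear f" and m: "AE w in M. f (- x) w = - f x w" using f by (auto simp: L0_linear_def)
  show "f x \<in> borel_measurable M" by (rule L0_sublinear_measurable[OF s])
  show "AE w in M. f (- x) w = - f x w" by (rule m)
  show "AE w in M. \<bar>f x w\<bar> \<le> nrm x w"
    using L0_sublinear_ge_nrm[OF s, of x] L0_sublinear_le_nrm[OF s, of x] by eventually_elim linarith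
  show "AE w in M. f y w \<le> f x w + nrm (y - x) w"
    using L0_sublinear_add[OF s, of x "y - x"] L0_sublinear_le_nrm[OF s, of "y - x"]
    by eventually_elim simp
qed

lemma L0_convexly_compact_Inter:
  assumes "L0_convexly_compact M smul nrm G"
    and "\<forall>A\<in>\<A>. A \<subseteq> G \<and> closedin (el_topology M nrm) A \<and> L0_convex M smul A"
    and "\<And>\<F>. \<lbrakk>\<F> \<subseteq> \<A>; finite \<F>\<rbrakk> \<Longrightarrow> \<Inter>\<F> \<noteq> {}"
  shows "\<Inter>\<A> \<noteq> {}"
  using assms unfolding L0_convexly_compact_def by auto

text \<open>
  If \<open>f\<close> were unbounded above on \<open>G\<close>, there would be a non-null event \<open>B\<close> for which all the
  sets \<open>{x \<in> G. f x \<ge> n on B}\<close> are nonempty.  They are closed, convex and decreasing, and no point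
  lies in all of them.
\<close>

lemma convexly_compact_L0_linear_bounded:
  assumes G: "L0_convexly_compact M smul nrm G" and f: "L0_linear f"
  shows "\<exists>b\<in>borel_measurable M. \<forall>g\<in>G. AE w in M. f g w \<le> b w"
proof (rule ccontr)
  assume unb: "\<not> ?thesis"
  note fm[measurable] = L0_linear_measurable[OF f]
  have G0: "G \<noteq> {}" "closedin (el_topology M nrm) G" "L0_convex M smul G"
    using G by (auto simp: L0_convexly_compact_def)
  have dir: "\<exists>z\<in>G. AE w in M. f x w \<le> f z w \<and> f y w \<le> f z w" if "x \<in> G" "y \<in> G" for x y
  proof -
    define \<xi> :: "'w \<Rightarrow> real" where "\<xi> w = (if f y w < f x w then 1 else 0)" for w
    have \<xi>m: "\<xi> \<in> borel_measurable M" unfolding \<xi>_def[abs_def] by measurable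
    have \<xi>: "\<xi> \<in> borel_measurable M" "AE w in M. 0 \<le> \<xi> w \<and> \<xi> w \<le> 1"
      by (fact \<xi>m) (simp add: \<xi>_def)
    have "AE w in M. f x w \<le> f (rcomb \<xi> x y) w \<and> f y w \<le> f (rcomb \<xi> x y) w"
      using L0_linear_rcomb_ge[where \<xi>=\<xi> and x=x and y=y, OF f \<xi>] by eventually_elim (auto simp: \<xi>_def split: if_splits)
    then show ?thesis using L0_convexD[OF G0(3) that \<xi>] by blast
  qed
  obtain A where A: "A \<in> events" "0 < prob A"
    and esc: "\<And>c \<epsilon>. \<lbrakk>c \<in> borel_measurable M; 0 < \<epsilon>\<rbrakk> \<Longrightarrow> \<exists>g\<in>G. prob {w \<in> A. f g w \<le> c w} < \<epsilon>"
    using unbounded_escape[OF G0(1) fm dir unb] by blast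
  have "\<exists>g\<in>G. prob {w \<in> A. f g w \<le> real n} < prob A / 2 ^ (n + 2)" for n :: nat
    using A(2) by (intro esc) auto
  then obtain g where g: "\<And>n. g n \<in> G" "\<And>n. prob {w \<in> A. f (g n) w \<le> real n} < prob A / 2 ^ (n + 2)"
    by metis
  define N where "N n = {w \<in> A. f (g n) w \<le> real n}" for n
  have N: "N n \<in> events" for n
  proof -
    have "N n = A \<inter> {w \<in> space M. f (g n) w \<le> real n}"
      using sets.sets_into_space[OF A(1)] by (auto simp: N_def)
    also have "\<dots> \<in> events" using A(1) by measurable
    finally show ?thesis .
  qed
  define B where "B = A - (\<Union>n. N n)"
  have B[measurable]: "B \<in> events" and pB: "0 < prob B"
    unfolding B_def using nonnull_remainder[OF A N] g(2) by (auto simp: N_def)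
  \<comment> \<open>On \<open>B\<close> the estimate holds for all \<open>n\<close> at once.\<close>
  have fB: "real n < f (g n) w" if "w \<in> B" for n w 
  proof -
    have "w \<in> A" "w \<notin> N n" using that by (auto simp: B_def)
    then show ?thesis by (simp add: N_def not_le)
  qed
  define \<phi> where "\<phi> n x w = indicator B w * (real n - f x w)" for n x w
  define C where "C n = G \<inter> {x. AE w in M. \<phi> n x w \<le> 0}" for n
  have cl: "closedin (el_topology M nrm) (C n)" for n
    unfolding C_def
  proof (intro closedin_Int G0(2) closedin_sublevel)
    show "\<phi> n x \<in> borel_measurable M" for x unfolding \<phi>_def[abs_def] by measurable
    show "AE w in M. \<phi> n x w \<le> \<phi> n y w + nrm (y - x) w" for x y
      using L0_linear_lipschitz[OF f, of y x] nrm_nonneg[of "y - x"]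
      by eventually_elim (auto simp: \<phi>_def indicator_def)
  qed
  have cv: "L0_convex M smul (C n)" for n
  proof (rule L0_convexI)
    fix x y and \<xi> :: "'w \<Rightarrow> real" assume xy: "x \<in> C n" "y \<in> C n" and \<xi>: "\<xi> \<in> borel_measurable M" "AE w in M. 0 \<le> \<xi> w \<and> \<xi> w \<le> 1"
    have x: "AE w in M. \<phi> n x w \<le> 0" and y: "AE w in M. \<phi> n y w \<le> 0" using xy by (auto simp: C_def)
    have "AE w in M. \<phi> n (rcomb \<xi> x y) w \<le> 0"
      using x y \<xi>(2) L0_linear_rcomb_ge[where \<xi>=\<xi> and x=x and y=y, OF f \<xi>]
    proof eventually_elim
      case (elim w)
      show ?case
      proof (cases "w \<in> B")
        case True
        then have "real n \<le> f x w" "real n \<le> f y w" using elim by (auto simp: \<phi>_def)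
        then have "\<xi> w * real n \<le> \<xi> w * f x w" "(1 - \<xi> w) * real n \<le> (1 - \<xi> w) * f y w"
          using elim(3) by (auto intro: mult_left_mono)
        then have "real n \<le> f (rcomb \<xi> x y) w" using elim(4) by (simp add: algebra_simps)
        then show ?thesis using True by (simp add: \<phi>_def)
      qed (simp add: \<phi>_def)
    qed
    then show "rcomb \<xi> x y \<in> C n" using L0_convexD[OF G0(3) _ _ \<xi>] xy by (auto simp: C_def)
  qed
  have gC: "g m \<in> C n" if "n \<le> m" for n m
  proof -
    have "\<phi> n (g m) w \<le> 0" for w
      using fB[of w m] that by (cases "w \<in> B") (auto simp: \<phi>_def)
    then show ?thesis using g(1) by (simp add: C_def)
  qed
  have fip: "\<Inter>\<F> \<noteq> {}" if F: "\<F> \<subseteq> range C" "finite \<F>" for \<F>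
  proof -
    obtain J where J: "finite J" "\<F> = C ` J" using finite_subset_image[OF F(2,1)] by blast
    then obtain m where "\<forall>j\<in>J. j \<le> m" using finite_nat_set_iff_bounded_le by blast
    then have "g m \<in> \<Inter>\<F>" using gC J(2) by auto
    then show ?thesis by blast
  qed
  have cc: "\<forall>D\<in>range C. D \<subseteq> G \<and> closedin (el_topology M nrm) D \<and> L0_convex M smul D"
    using cl cv by (auto simp: C_def)
  have "\<Inter>(range C) \<noteq> {}" by (rule L0_convexly_compact_Inter[OF G cc]) (rule fip)
  then obtain x where x: "\<And>n. x \<in> C n" by auto
  then have "\<And>n. AE w in M. \<phi> n x w \<le> 0" by (auto simp: C_def)
  then have "AE w in M. \<forall>n. \<phi> n x w \<le> 0" by (simp add: AE_all_countable)
  then have "AE w in M. w \<notin> B"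
  proof eventually_elim
    case (elim w)
    obtain n :: nat where "f x w < real n" using reals_Archimedean2 by blast
    then show ?case using elim[rule_format, of n] by (auto simp: \<phi>_def)
  qed
  then have "prob B = 0" by (simp add: prob_eq_0)
  then show False using pB by simp
qed

lemma third_powers: "(\<lambda>n. (1/3) ^ (n + 1 + m) :: real) sums ((1/3) ^ m / 2)"
  using sums_mult[OF geometric_sums[of "1/3 :: real"], of "(1/3) ^ (Suc m)"]
  by (simp add: power_add field_simps)

lemma summable_third:
  assumes "\<And>n. \<bar>u n\<bar> \<le> (b::real)"
  shows "summable (\<lambda>n. (1/3) ^ (n + 1 + m) * u n)"
proof (rule summable_comparison_test')
  show "summable (\<lambda>n. b * (1/3) ^ (n + 1 + m))"
    by (rule summable_mult[OF sums_summable[OF third_powers]])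
  show "norm ((1/3) ^ (n + 1 + m) * u n) \<le> b * (1/3) ^ (n + 1 + m)" for n
    using assms[of n] by (simp add: abs_mult)
qed

lemma suminf_third_le:
  assumes "\<And>n. \<bar>u n\<bar> \<le> (b::real)"
  shows "\<bar>\<Sum>n. (1/3) ^ (n + 1 + m) * u n\<bar> \<le> (1/3) ^ m / 2 * b"
proof -
  have sb: "(\<lambda>n. (1/3) ^ (n + 1 + m) * b) sums ((1/3) ^ m / 2 * b)"
    by (rule sums_mult2[OF third_powers])
  have v: "\<bar>(1/3) ^ (n + 1 + m) * u n\<bar> \<le> (1/3) ^ (n + 1 + m) * b" for n
    using assms[of n] by (simp add: abs_mult)
  have sa: "summable (\<lambda>n. \<bar>(1/3) ^ (n + 1 + m) * u n\<bar>)"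
    by (rule summable_comparison_test'[OF sums_summable[OF sb], of 0]) (simp only: real_norm_def abs_idempotent v)
  have "\<bar>\<Sum>n. (1/3) ^ (n + 1 + m) * u n\<bar> \<le> (\<Sum>n. \<bar>(1/3) ^ (n + 1 + m) * u n\<bar>)"
    by (rule summable_rabs[OF sa])
  also have "\<dots> \<le> (\<Sum>n. (1/3) ^ (n + 1 + m) * b)"
    by (rule suminf_le[OF v sa sums_summable[OF sb]])
  finally show ?thesis using sb by (simp add: sums_iff)
qed

text \<open>
  The values at one point are dominated by its norm for all \<open>n\<close> simultaneously, outside a single null
  set; there the series converges absolutely and inherits the inequalities of its terms.
\<close>

lemma L0_linear_series:
  assumes f: "\<And>n. L0_linear (f n)"
  shows "L0_linear (\<lambda>x w. \<Sum>n. (1/3) ^ (n + 1) * f n x w)"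
proof -
  note [measurable] = L0_linear_measurable[OF f]
  define F where "F x w = (\<Sum>n. (1/3) ^ (n + 1) * f n x w)" for x w
  have s: "L0_sublinear (f n)" for n using f by (auto simp: L0_linear_def)
  have b: "AE w in M. \<forall>n. \<bar>f n x w\<bar> \<le> nrm x w" for x
    using L0_linear_abs_le[OF f] by (simp add: AE_all_countable)
  have sm: "summable (\<lambda>n. (1/3) ^ (n + 1) * f n x w)" if "\<forall>n. \<bar>f n x w\<bar> \<le> nrm x w" for x w
    using summable_third[of "\<lambda>n. f n x w" "nrm x w" 0] that by simp
  have "L0_sublinear F"
    unfolding L0_sublinear_def
  proof (intro conjI allI impI)
    show "F x \<in> borel_measurable M" for x unfolding F_def[abs_def] by measurable
    show "AE w in M. F (x + y) w \<le> F x w + F y w" for x y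
    proof -
      have "AE w in M. \<forall>n. f n (x + y) w \<le> f n x w + f n y w"
        using L0_sublinear_add[OF s] by (simp add: AE_all_countable)
      with b[of x] b[of y] b[of "x + y"] show ?thesis
      proof eventually_elim
        case (elim w)
        have "F (x + y) w \<le> (\<Sum>n. (1/3) ^ (n + 1) * f n x w + (1/3) ^ (n + 1) * f n y w)"
          unfolding F_def
          by (intro suminf_le sm summable_add elim)
            (use elim(4) in \<open>auto simp: distrib_left[symmetric] simp del: distrib_left_numeral\<close>)
        also have "\<dots> = F x w + F y w"
          unfolding F_def by (intro suminf_add[symmetric] sm elim)
        finally show ?case .
      qed
    qed
    show "AE w in M. F (rsmul \<xi> x) w \<le> \<xi> w * F x w"
      if \<xi>: "\<xi> \<in> borel_measurable M \<and> (AE w in M. 0 \<le> \<xi> w)" for \<xi> x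
    proof -
      have "AE w in M. \<forall>n. f n (rsmul \<xi> x) w \<le> \<xi> w * f n x w"
        using L0_sublinear_rsmul[OF s] \<xi> by (simp add: AE_all_countable)
      with b[of x] b[of "rsmul \<xi> x"] show ?thesis
      proof eventually_elim
        case (elim w)
        have "F (rsmul \<xi> x) w \<le> (\<Sum>n. \<xi> w * ((1/3) ^ (n + 1) * f n x w))"
          unfolding F_def
          by (intro suminf_le sm summable_mult elim) (use elim(3) in \<open>simp add: mult.left_commute\<close>)
        also have "\<dots> = \<xi> w * F x w" unfolding F_def by (intro suminf_mult sm elim)
        finally show ?case .
      qed
    qed
    show "AE w in M. F x w \<le> nrm x w" for x
      using b[of x] nrm_nonneg[of x]
    proof eventually_elim
      case (elim w)
      then show ?case using suminf_third_le[of "\<lambda>n. f n x w" "nrm x w" 0] by (simp add: F_def)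
    qed
  qed
  moreover have "AE w in M. F (- x) w = - F x w" for x
  proof -
    have "AE w in M. \<forall>n. f n (- x) w = - f n x w"
      using L0_linear_uminus[OF f] by (simp add: AE_all_countable)
    with b[of x] show ?thesis
    proof eventually_elim
      case (elim w)
      then show ?case unfolding F_def using suminf_minus[OF sm[of x w]] by simp
    qed
  qed
  ultimately show ?thesis unfolding L0_linear_def F_def[abs_def] by blast
qed

text \<open>
  A gliding hump.  Every linear functional is bounded on \<open>G\<close>, but the bound depends on the functional.
  If the norm were unbounded on \<open>G\<close>, choose successively points \<open>a n\<close> with norming functionals
  \<open>f (a n)\<close>, such that off a small event the norm of \<open>a n\<close> is large compared with the bounds of the
  preceding functionals.  In the series of these functionals with coefficients \<open>(1/3) ^ (n + 1)\<close>,
  evaluated at \<open>a n\<close>, the \<open>n\<close>-th term is at least twice as large as all later terms together, and half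
  of it exceeds the earlier terms by more than \<open>n\<close>.  So the sum would be a linear functional that is
  unbounded on \<open>G\<close>.
\<close>

theorem convexly_compact_bounded:
  assumes G: "L0_convexly_compact M smul nrm G"
  shows "\<exists>b\<in>borel_measurable M. \<forall>g\<in>G. AE w in M. nrm g w \<le> b w"
proof (rule ccontr)
  assume unb: "\<not> ?thesis"
  have G0: "G \<noteq> {}" "L0_convex M smul G" using G by (auto simp: L0_convexly_compact_def)
  have dir: "\<exists>z\<in>G. AE w in M. nrm x w \<le> nrm z w \<and> nrm y w \<le> nrm z w" if "x \<in> G" "y \<in> G" for x y
  proof -
    define \<xi> :: "'w \<Rightarrow> real" where "\<xi> w = (if nrm y w < nrm x w then 1 else 0)" for w
    have \<xi>m: "\<xi> \<in> borel_measurable M" unfolding \<xi>_def[abs_def] by measurable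
    have \<xi>: "\<xi> \<in> borel_measurable M" "AE w in M. 0 \<le> \<xi> w \<and> \<xi> w \<le> 1"
      by (fact \<xi>m) (simp add: \<xi>_def)
    have "AE w in M. nrm (rcomb \<xi> x y) w = (if \<xi> w = 1 then nrm x w else nrm y w)"
      by (rule nrm_glue[OF \<xi>(1)]) (simp add: \<xi>_def)
    then have "AE w in M. nrm x w \<le> nrm (rcomb \<xi> x y) w \<and> nrm y w \<le> nrm (rcomb \<xi> x y) w"
      by eventually_elim (auto simp: \<xi>_def split: if_splits)
    then show ?thesis using L0_convexD[OF G0(2) that \<xi>] by blast
  qed
  obtain A where A: "A \<in> events" "0 < prob A"
    and esc: "\<And>c \<epsilon>. \<lbrakk>c \<in> borel_measurable M; 0 < \<epsilon>\<rbrakk> \<Longrightarrow> \<exists>g\<in>G. prob {w \<in> A. nrm g w \<le> c w} < \<epsilon>"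
    using unbounded_escape[OF G0(1) nrm_measurable dir unb] by blast
  have "\<exists>f. \<forall>a. L0_linear (f a) \<and> (AE w in M. nrm a w \<le> f a a w)"
    by (rule choice[where Q = "\<lambda>a f. L0_linear f \<and> (AE w in M. nrm a w \<le> f a w)"]) (intro allI L0_Hahn_Banach)
  then obtain f where f: "\<And>a. L0_linear (f a)" "\<And>a. AE w in M. nrm a w \<le> f a a w" by blast
  let ?Q = "\<lambda>a b. b \<in> borel_measurable M \<and> (\<forall>w. 0 \<le> b w) \<and> (\<forall>g\<in>G. AE w in M. \<bar>f a g w\<bar> \<le> b w)"
  have "\<exists>b. ?Q a b" for a
  proof -
    obtain b1 where b1: "b1 \<in> borel_measurable M" "\<forall>g\<in>G. AE w in M. f a g w \<le> b1 w"
      using convexly_compact_L0_linear_bounded[OF G f(1)] by blast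
    obtain b2 where b2: "b2 \<in> borel_measurable M" "\<forall>g\<in>G. AE w in M. f a (- g) w \<le> b2 w"
      using convexly_compact_L0_linear_bounded[OF G L0_linear_minus[OF f(1)]] by blast
    have "AE w in M. \<bar>f a g w\<bar> \<le> \<bar>b1 w\<bar> + \<bar>b2 w\<bar>" if "g \<in> G" for g
      using bspec[OF b1(2) that] bspec[OF b2(2) that] L0_linear_uminus[OF f(1), of a g]
      by eventually_elim linarith
    then have "?Q a (\<lambda>w. \<bar>b1 w\<bar> + \<bar>b2 w\<bar>)" using b1(1) b2(1) by simp
    then show ?thesis by (rule exI[where P = "?Q a"])
  qed
  then have "\<exists>b. \<forall>a. ?Q a (b a)" using choice[where Q = ?Q] by simp
  then obtain b where "\<forall>a. ?Q a (b a)" by (rule exE)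
  then have b[measurable]: "\<And>a. b a \<in> borel_measurable M" and b0: "\<And>a w. 0 \<le> b a w"
    and fb: "\<And>a g. g \<in> G \<Longrightarrow> AE w in M. \<bar>f a g w\<bar> \<le> b a w" by blast+
  \<comment> \<open>A state \<open>(a, c)\<close> consists of the current point and a majorant \<open>c\<close> of the sum of the bounds of all earlier functionals.\<close>
  define bad where "bad n s = {w \<in> A. nrm (fst s) w \<le> 2 * 3 ^ (n + 1) * (real n + snd s w)}"
    for n and s :: "'e \<times> ('w \<Rightarrow> real)"
  define P where "P n s \<longleftrightarrow> fst s \<in> G \<and> snd s \<in> borel_measurable M \<and> (\<forall>w. 0 \<le> snd s w) \<and>
    prob (bad n s) < prob A / 2 ^ (n + 2)" for n s
  define R where "R s s' \<longleftrightarrow> snd s' = (\<lambda>w. snd s w + b (fst s) w)" for s s' :: "'e \<times> ('w \<Rightarrow> real)"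
  have step: "\<exists>a. P n (a, c)" if [measurable]: "c \<in> borel_measurable M" and "\<forall>w. 0 \<le> c w" for n c
  proof -
    have "\<exists>g\<in>G. prob {w \<in> A. nrm g w \<le> 2 * 3 ^ (n + 1) * (real n + c w)} < prob A / 2 ^ (n + 2)"
      using A(2) by (intro esc) auto
    then show ?thesis using that by (auto simp: P_def bad_def)
  qed
  have "\<exists>s. \<forall>n. P n (s n) \<and> R (s n) (s (Suc n))"
  proof (rule dependent_nat_choice)
    show "\<exists>s. P 0 s" using step[of "\<lambda>_. 0" 0] by auto
    fix s n assume "P n s"
    then have "snd s \<in> borel_measurable M" "\<forall>w. 0 \<le> snd s w" by (auto simp: P_def)
    then have "\<exists>a. P (Suc n) (a, \<lambda>w. snd s w + b (fst s) w)" using b0 by (intro step) auto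
    then show "\<exists>s'. P (Suc n) s' \<and> R s s'" by (auto simp: R_def)
  qed
  then obtain s where s: "\<And>n. P n (s n)" "\<And>n. R (s n) (s (Suc n))" by blast
  define a where "a n = fst (s n)" for n
  define c where "c n = snd (s n)" for n
  have aG: "a n \<in> G" and cm[measurable]: "c n \<in> borel_measurable M" and c0: "0 \<le> c n w" for n w
    using s(1)[of n] by (auto simp: P_def a_def c_def)
  have cS: "c (Suc n) w = c n w + b (a n) w" for n w using s(2)[of n] by (simp add: R_def a_def c_def)
  have cs: "(\<Sum>i<n. b (a i) w) \<le> c n w" for n w
  proof (induction n)
    case 0 show ?case using c0 by simp
  next
    case (Suc n) then show ?case by (simp add: cS)
  qed
  define N where "N n = bad n (s n)" for n
  have N: "N n \<in> events" for n
  proof -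
    have "N n = A \<inter> {w \<in> space M. nrm (a n) w \<le> 2 * 3 ^ (n + 1) * (real n + c n w)}"
      using sets.sets_into_space[OF A(1)] by (auto simp: N_def bad_def a_def c_def)
    also have "\<dots> \<in> events" using A(1) by measurable
    finally show ?thesis .
  qed
  define B where "B = A - (\<Union>n. N n)"
  have B[measurable]: "B \<in> events" and pB: "0 < prob B"
    unfolding B_def using nonnull_remainder[OF A N] s(1) by (auto simp: N_def P_def)
  have nB: "2 * 3 ^ (n + 1) * (real n + c n w) < nrm (a n) w" if "w \<in> B" for n w
  proof -
    have "w \<in> A" "w \<notin> N n" using that by (auto simp: B_def)
    then show ?thesis by (simp add: N_def bad_def a_def c_def not_le)
  qed
  define F where "F x w = (\<Sum>n. (1/3) ^ (n + 1) * f (a n) x w)" for x w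
  have "L0_linear F" unfolding F_def[abs_def] by (rule L0_linear_series[OF f(1)])
  then obtain d where d: "d \<in> borel_measurable M" "\<forall>g\<in>G. AE w in M. F g w \<le> d w"
    using convexly_compact_L0_linear_bounded[OF G] by blast
  \<comment> \<open>Split the series at the hump: earlier terms are at least \<open>- c n\<close>, later ones at least minus half of the hump.\<close>
  have big: "AE w in M. w \<in> B \<longrightarrow> real n < F (a n) w" for n
  proof -
    have "AE w in M. \<forall>i. \<bar>f (a i) (a n) w\<bar> \<le> nrm (a n) w"
      using L0_linear_abs_le[OF f(1)] by (simp add: AE_all_countable)
    moreover have "AE w in M. \<forall>i. \<bar>f (a i) (a n) w\<bar> \<le> b (a i) w"
      using fb[OF aG] by (simp add: AE_all_countable)
    ultimately show ?thesis using f(2)[of "a n"]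
    proof eventually_elim
      case (elim w)
      show ?case
      proof
        assume w: "w \<in> B"
        let ?u = "\<lambda>i. f (a i) (a n) w" and ?k = "(1/3::real) ^ (n + 1)"
        have "F (a n) w = (\<Sum>i. (1/3) ^ (i + Suc n + 1) * ?u (i + Suc n)) + (\<Sum>i<Suc n. (1/3) ^ (i + 1) * ?u i)"
          unfolding F_def
          by (rule suminf_split_initial_segment) (use summable_third[of ?u "nrm (a n) w" 0] elim in simp)
        moreover have "- (?k / 2 * nrm (a n) w) \<le> (\<Sum>i. (1/3) ^ (i + Suc n + 1) * ?u (i + Suc n))"
          using suminf_third_le[of "\<lambda>i. ?u (i + Suc n)" "nrm (a n) w" "Suc n"] elim(1)
          by (simp add: add.commute add.left_commute)
        moreover have "- c n w \<le> (\<Sum>i<n. (1/3) ^ (i + 1) * ?u i)"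
        proof -
          have "\<bar>(1/3) ^ (i + 1) * ?u i\<bar> \<le> b (a i) w" for i
          proof -
            have "\<bar>(1/3) ^ (i + 1) * ?u i\<bar> \<le> 1 * \<bar>?u i\<bar>"
              unfolding abs_mult by (intro mult_right_mono) (simp_all add: power_le_one del: power_Suc)
            with elim(2) show ?thesis by (metis mult_1 order_trans)
          qed
          then have "- b (a i) w \<le> (1/3) ^ (i + 1) * ?u i" for i by (simp add: abs_le_iff minus_le_iff)
          then have "(\<Sum>i<n. - b (a i) w) \<le> (\<Sum>i<n. (1/3) ^ (i + 1) * ?u i)" by (intro sum_mono)
          with cs[of w n] show ?thesis by (simp add: sum_negf)
        qed
        moreover have "?k * nrm (a n) w \<le> ?k * ?u n" using elim(3) by (intro mult_left_mono) auto
        moreover have "real n + c n w < ?k / 2 * nrm (a n) w"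
          using nB[OF w, of n] by (simp add: field_simps power_divide)
        ultimately show "real n < F (a n) w" unfolding sum.lessThan_Suc by linarith
      qed
    qed
  qed
  have "AE w in M. \<forall>n. w \<in> B \<longrightarrow> real n < F (a n) w" using big by (simp only: AE_all_countable) blast
  moreover have "AE w in M. \<forall>n. F (a n) w \<le> d w" using d(2) aG by (simp add: AE_all_countable)
  ultimately have "AE w in M. w \<notin> B"
  proof eventually_elim
    case (elim w)
    obtain n :: nat where "d w < real n" using reals_Archimedean2 by blast
    then show ?case using elim(1)[rule_format, of n] elim(2)[rule_format, of n] by linarith
  qed
  then have "prob B = 0" by (simp add: prob_eq_0)
  then show False using pB by simp
qed

section \<open>Random Chebyshev centers\<close>

lemma rad_pt_family: "{\<lambda>w. ereal (nrm (x - y) w) |y. y \<in> H} \<subseteq> borel_measurable M"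
  by auto

lemma rad_pt_measurable [measurable]: "rad_pt M nrm H x \<in> borel_measurable M"
  unfolding rad_pt_def by (rule L0_Sup_measurable[OF rad_pt_family])

lemma rad_pt_upper: "y \<in> H \<Longrightarrow> AE w in M. ereal (nrm (x - y) w) \<le> rad_pt M nrm H x w"
  unfolding rad_pt_def by (rule L0_Sup_upper[OF rad_pt_family]) blast

lemma rad_pt_least:
  assumes t: "t \<in> borel_measurable M" and le: "\<And>y. y \<in> H \<Longrightarrow> AE w in M. ereal (nrm (x - y) w) \<le> t w"
  shows "AE w in M. rad_pt M nrm H x w \<le> t w"
  unfolding rad_pt_def by (rule L0_Sup_least[OF rad_pt_family t]) (use le in blast)

lemma rad_pt_finite:
  assumes "H \<noteq> {}" and b[measurable]: "b \<in> borel_measurable M" "\<And>y. y \<in> H \<Longrightarrow> AE w in M. nrm y w \<le> b w"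
  obtains r where "r \<in> borel_measurable M" "AE w in M. rad_pt M nrm H x w = ereal (r w)"
proof -
  obtain y0 where y0: "y0 \<in> H" using assms(1) by auto
  have "AE w in M. rad_pt M nrm H x w \<le> ereal (nrm x w + b w)"
  proof (rule rad_pt_least)
    fix y assume y: "y \<in> H"
    show "AE w in M. ereal (nrm (x - y) w) \<le> ereal (nrm x w + b w)"
      using nrm_triangle[of x "- y"] nrm_minus[of y] b(2)[OF y] by eventually_elim simp
  qed measurable
  with rad_pt_upper[OF y0, of x]
  have "AE w in M. rad_pt M nrm H x w = ereal (real_of_ereal (rad_pt M nrm H x w))"
  proof eventually_elim
    case (elim w) then show ?case by (cases "rad_pt M nrm H x w") auto
  qed
  then show ?thesis by (intro that[of "\<lambda>w. real_of_ereal (rad_pt M nrm H x w)"]) auto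
qed

text \<open>
  The Chebyshev center of \<open>K\<close> in \<open>K\<close>, expressed by minimality of the radius instead of by an
  essential infimum.  The two agree as soon as the minimum is attained
  (\<open>random_center_eq_centers\<close>), and the existence of the infimum then comes for free.
\<close>

definition centers :: "'e set \<Rightarrow> 'e set"
  where "centers K = {x \<in> K. \<forall>y\<in>K. AE w in M. rad_pt M nrm K x w \<le> rad_pt M nrm K y w}"

lemma random_center_eq_centers:
  assumes "centers K \<noteq> {}"
  shows "random_center M nrm K K = centers K"
proof -
  let ?R = "rad_pt M nrm K"
  obtain c where c: "c \<in> K" "\<And>y. y \<in> K \<Longrightarrow> AE w in M. ?R c w \<le> ?R y w"
    using assms by (auto simp: centers_def)
  let ?P = "\<lambda>s. s \<in> borel_measurable M \<and> (\<forall>f\<in>{?R x |x. x \<in> K}. AE w in M. s w \<le> f w) \<and>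
    (\<forall>t\<in>borel_measurable M. (\<forall>f\<in>{?R x |x. x \<in> K}. AE w in M. t w \<le> f w) \<longrightarrow> (AE w in M. t w \<le> s w))"
  have "?P (?R c)" using c by auto
  then have "?P (rad_set M nrm K K)" unfolding rad_set_def L0_Inf_def by (rule someI[where P = ?P])
  then have l: "AE w in M. rad_set M nrm K K w \<le> ?R c w"
    and g: "\<forall>t\<in>borel_measurable M. (\<forall>f\<in>{?R x |x. x \<in> K}. AE w in M. t w \<le> f w) \<longrightarrow>
      (AE w in M. t w \<le> rad_set M nrm K K w)"
    using c(1) by blast+
  have "AE w in M. ?R c w \<le> rad_set M nrm K K w"
    by (rule g[rule_format, OF rad_pt_measurable]) (use c(2) in auto)
  with l have eq: "AE w in M. rad_set M nrm K K w = ?R c w" by eventually_elim (rule antisym)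
  have "(AE w in M. ?R x w = rad_set M nrm K K w) \<longleftrightarrow> (\<forall>y\<in>K. AE w in M. ?R x w \<le> ?R y w)"
    if x: "x \<in> K" for x
  proof (intro iffI ballI)
    fix y assume e: "AE w in M. ?R x w = rad_set M nrm K K w" and y: "y \<in> K"
    show "AE w in M. ?R x w \<le> ?R y w" using e eq c(2)[OF y] by eventually_elim simp
  next
    assume "\<forall>y\<in>K. AE w in M. ?R x w \<le> ?R y w"
    then have "AE w in M. ?R x w \<le> ?R c w" using c(1) by blast
    then show "AE w in M. ?R x w = rad_set M nrm K K w"
      using c(2)[OF x] eq by eventually_elim simp
  qed
  then show ?thesis unfolding random_center_def centers_def by blast
qed

definition radius_level :: "'e set \<Rightarrow> ('w \<Rightarrow> real) \<Rightarrow> 'e set"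
  where "radius_level K r = {x \<in> K. \<forall>z\<in>K. AE w in M. nrm (x - z) w \<le> r w}"

lemma closedin_radius_level:
  assumes [measurable]: "r \<in> borel_measurable M" and K: "K \<noteq> {}" "closedin (el_topology M nrm) K"
  shows "closedin (el_topology M nrm) (radius_level K r)"
proof -
  have "radius_level K r = K \<inter> (\<Inter>z\<in>K. {x. AE w in M. nrm (x - z) w - r w \<le> 0})"
    by (auto simp: radius_level_def)
  moreover have "closedin (el_topology M nrm) {x. AE w in M. nrm (x - z) w - r w \<le> 0}" for z
  proof (rule closedin_sublevel)
    show "AE w in M. nrm (x - z) w - r w \<le> nrm (y - z) w - r w + nrm (y - x) w" for x y
      using nrm_triangle[of "y - z" "x - y"] nrm_minus_commute[of x y]
      by eventually_elim (simp add: algebra_simps)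
  qed measurable
  ultimately show ?thesis using K by (auto intro!: closedin_Int closedin_INT)
qed

lemma L0_convex_radius_level:
  assumes K: "L0_convex M smul K"
  shows "L0_convex M smul (radius_level K r)"
proof (rule L0_convexI)
  fix x y and \<xi> :: "'w \<Rightarrow> real" assume xy: "x \<in> radius_level K r" "y \<in> radius_level K r"
    and \<xi>: "\<xi> \<in> borel_measurable M" "AE w in M. 0 \<le> \<xi> w \<and> \<xi> w \<le> 1"
  have "AE w in M. nrm (rcomb \<xi> x y - z) w \<le> r w" if z: "z \<in> K" for z
  proof -
    have "AE w in M. nrm (x - z) w \<le> r w" "AE w in M. nrm (y - z) w \<le> r w"
      using xy z by (auto simp: radius_level_def)
    then show ?thesis
      using nrm_rcomb_le[where \<xi>=\<xi> and x="x - z" and y="y - z", OF \<xi>] \<xi>(2) unfolding rcomb_diff[OF \<xi>(1)]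
    proof eventually_elim
      case (elim w)
      then have "\<xi> w * nrm (x - z) w \<le> \<xi> w * r w" "(1 - \<xi> w) * nrm (y - z) w \<le> (1 - \<xi> w) * r w"
        by (auto intro: mult_left_mono)
      then show ?case using elim(3) by (simp add: algebra_simps)
    qed
  qed
  then show "rcomb \<xi> x y \<in> radius_level K r"
    using L0_convexD[OF K _ _ \<xi>] xy by (auto simp: radius_level_def)
qed

text \<open>
  For \<open>x \<in> K\<close> the set of all \<open>y \<in> K\<close> with \<open>R(K, y) \<le> R(K, x)\<close> is closed and convex, being a
  \<open>radius_level\<close>.  Finitely many of these sets have a common point, since
  two points can be pasted to one whose radius is the minimum of their radii.  A point common to
  all of them has minimal radius, and its own level set is the center.
\<close>

lemma centers_closed_convex:
  assumes G: "L0_convexly_compact M smul nrm G"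
    and KG: "K \<subseteq> G" and K: "K \<noteq> {}" "closedin (el_topology M nrm) K" "L0_convex M smul K"
  shows "centers K \<noteq> {}" "closedin (el_topology M nrm) (centers K)" "L0_convex M smul (centers K)"
proof -
  let ?R = "rad_pt M nrm K"
  obtain b where b: "b \<in> borel_measurable M" "\<And>g. g \<in> G \<Longrightarrow> AE w in M. nrm g w \<le> b w"
    using convexly_compact_bounded[OF G] by blast
  let ?Q = "\<lambda>x r. r \<in> borel_measurable M \<and> (AE w in M. ?R x w = ereal (r w))"
  have "\<exists>r. ?Q x r" for x
  proof (rule rad_pt_finite[OF K(1) b(1)])
    show "AE w in M. nrm y w \<le> b w" if "y \<in> K" for y using b(2) KG that by blast
  qed blast
  then have "\<exists>r. \<forall>x. ?Q x (r x)" using choice[where Q = ?Q] by simp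
  then obtain r where r[measurable]: "\<And>x. r x \<in> borel_measurable M" and Rr: "\<And>x. AE w in M. ?R x w = ereal (r x w)"
    by blast
  have level: "y \<in> radius_level K (r x) \<longleftrightarrow> (AE w in M. ?R y w \<le> ?R x w)" if y: "y \<in> K" for x y
  proof
    assume "y \<in> radius_level K (r x)"
    then have "AE w in M. ?R y w \<le> ereal (r x w)"
      by (intro rad_pt_least) (auto simp: radius_level_def)
    with Rr[of x] show "AE w in M. ?R y w \<le> ?R x w" by eventually_elim simp
  next
    assume le: "AE w in M. ?R y w \<le> ?R x w"
    have "AE w in M. nrm (y - z) w \<le> r x w" if "z \<in> K" for z
      using rad_pt_upper[OF that, of y] le Rr[of x]
      by eventually_elim (metis ereal_less_eq(3) order_trans)
    then show "y \<in> radius_level K (r x)" using y by (simp add: radius_level_def)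
  qed
  have dir: "\<exists>z\<in>K. (AE w in M. ?R z w \<le> ?R x w) \<and> (AE w in M. ?R z w \<le> ?R y w)"
    if xy: "x \<in> K" "y \<in> K" for x y
  proof -
    define \<xi> :: "'w \<Rightarrow> real" where "\<xi> w = (if r x w < r y w then 1 else 0)" for w
    have \<xi>m: "\<xi> \<in> borel_measurable M" unfolding \<xi>_def[abs_def] by measurable
    have \<xi>: "\<xi> \<in> borel_measurable M" "AE w in M. 0 \<le> \<xi> w \<and> \<xi> w \<le> 1"
      by (fact \<xi>m) (simp add: \<xi>_def)
    have "AE w in M. ?R (rcomb \<xi> x y) w \<le> ereal (min (r x w) (r y w))"
    proof (rule rad_pt_least)
      fix z assume z: "z \<in> K"
      show "AE w in M. ereal (nrm (rcomb \<xi> x y - z) w) \<le> ereal (min (r x w) (r y w))"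
        using nrm_rcomb_le[where \<xi>=\<xi> and x="x - z" and y="y - z", OF \<xi>] rad_pt_upper[OF z, of x] rad_pt_upper[OF z, of y]
          Rr[of x] Rr[of y] unfolding rcomb_diff[OF \<xi>m]
        by eventually_elim (auto simp: \<xi>_def split: if_splits)
    qed measurable
    then have "AE w in M. ?R (rcomb \<xi> x y) w \<le> ?R x w" "AE w in M. ?R (rcomb \<xi> x y) w \<le> ?R y w"
      using Rr[of x] Rr[of y] by (eventually_elim, simp)+
    then show ?thesis using L0_convexD[OF K(3) xy \<xi>] by blast
  qed
  have fin: "\<exists>z\<in>K. \<forall>x\<in>J. AE w in M. ?R z w \<le> ?R x w" if "finite J" "J \<subseteq> K" for J
    using that
  proof (induction J rule: finite_induct)
    case empty then show ?case using K(1) by auto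
  next
    case (insert x J)
    then obtain z where z: "z \<in> K" "\<And>x. x \<in> J \<Longrightarrow> AE w in M. ?R z w \<le> ?R x w" by blast
    obtain z' where z': "z' \<in> K" "AE w in M. ?R z' w \<le> ?R x w" "AE w in M. ?R z' w \<le> ?R z w"
      using dir[of x z] insert.prems z(1) by blast
    have "AE w in M. ?R z' w \<le> ?R u w" if "u \<in> J" for u
      using z'(3) z(2)[OF that] by eventually_elim (rule order_trans)
    then show ?case using z' by blast
  qed
  let ?\<A> = "(\<lambda>x. radius_level K (r x)) ` K"
  have cc: "\<forall>A\<in>?\<A>. A \<subseteq> G \<and> closedin (el_topology M nrm) A \<and> L0_convex M smul A"
    using closedin_radius_level[OF r K(1,2)] L0_convex_radius_level[OF K(3)] KG
    by (auto simp: radius_level_def)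
  have fip: "\<Inter>\<F> \<noteq> {}" if F: "\<F> \<subseteq> ?\<A>" "finite \<F>" for \<F>
  proof -
    obtain J where J: "J \<subseteq> K" "finite J" "\<F> = (\<lambda>x. radius_level K (r x)) ` J"
      using finite_subset_image[OF F(2,1)] by blast
    obtain z where "z \<in> K" "\<forall>x\<in>J. AE w in M. ?R z w \<le> ?R x w" using fin[OF J(2,1)] by blast
    then have "z \<in> \<Inter>\<F>" using level by (auto simp: J(3))
    then show ?thesis by blast
  qed
  have "\<Inter>?\<A> \<noteq> {}" by (rule L0_convexly_compact_Inter[OF G cc]) (rule fip)
  then obtain c where c: "\<And>x. x \<in> K \<Longrightarrow> c \<in> radius_level K (r x)" by auto
  have cK: "c \<in> K" using c K(1) by (auto simp: radius_level_def)
  have cmin: "AE w in M. ?R c w \<le> ?R y w" if "y \<in> K" for y using c[OF that] level[OF cK] by blast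
  then have "c \<in> centers K" using cK by (simp add: centers_def)
  then show "centers K \<noteq> {}" by blast
  have "centers K = radius_level K (r c)"
  proof (intro set_eqI iffI)
    fix x assume "x \<in> centers K"
    then show "x \<in> radius_level K (r c)" using level cK by (auto simp: centers_def)
  next
    fix x assume x: "x \<in> radius_level K (r c)"
    then have xK: "x \<in> K" by (simp add: radius_level_def)
    then have le: "AE w in M. ?R x w \<le> ?R c w" using level x by blast
    have "AE w in M. ?R x w \<le> ?R y w" if "y \<in> K" for y
      using le cmin[OF that] by eventually_elim (rule order_trans)
    with xK show "x \<in> centers K" by (simp add: centers_def)
  qed
  then show "closedin (el_topology M nrm) (centers K)" "L0_convex M smul (centers K)"
    using closedin_radius_level[OF r K(1,2)] L0_convex_radius_level[OF K(3)] by auto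
qed

text \<open>
  A surjective isometry of \<open>K\<close> preserves the radius \<open>R(K, x)\<close>, because it permutes the points over
  which the supremum is taken.
\<close>

lemma isometry_image_centers:
  assumes T: "random_isometric M nrm K T" "T ` K = K"
  shows "T ` centers K = centers K"
proof -
  let ?R = "rad_pt M nrm K"
  have iso: "AE w in M. nrm (T x - T y) w = nrm (x - y) w" if "x \<in> K" "y \<in> K" for x y
    using T(1) that by (auto simp: random_isometric_def)
  have R: "AE w in M. ?R (T x) w = ?R x w" if x: "x \<in> K" for x
  proof -
    have "AE w in M. ?R (T x) w \<le> ?R x w"
    proof (rule rad_pt_least)
      fix y assume "y \<in> K"
      then obtain y' where y': "y' \<in> K" "y = T y'" using T(2) by blast
      show "AE w in M. ereal (nrm (T x - y) w) \<le> ?R x w"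
        using iso[OF x y'(1)] rad_pt_upper[OF y'(1), of x] unfolding y'(2) by eventually_elim simp
    qed measurable
    moreover have "AE w in M. ?R x w \<le> ?R (T x) w"
    proof (rule rad_pt_least)
      fix y assume y: "y \<in> K"
      then have Ty: "T y \<in> K" using T(2) by blast
      show "AE w in M. ereal (nrm (x - y) w) \<le> ?R (T x) w"
        using iso[OF x y] rad_pt_upper[OF Ty, of "T x"] by eventually_elim simp
    qed measurable
    ultimately show ?thesis by eventually_elim (rule antisym)
  qed
  have iff: "T x \<in> centers K \<longleftrightarrow> x \<in> centers K" if x: "x \<in> K" for x
  proof -
    have "(AE w in M. ?R (T x) w \<le> ?R y w) \<longleftrightarrow> (AE w in M. ?R x w \<le> ?R y w)" for y
    proof
      assume "AE w in M. ?R (T x) w \<le> ?R y w"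
      with R[OF x] show "AE w in M. ?R x w \<le> ?R y w" by eventually_elim simp
    next
      assume "AE w in M. ?R x w \<le> ?R y w"
      with R[OF x] show "AE w in M. ?R (T x) w \<le> ?R y w" by eventually_elim simp
    qed
    then show ?thesis using x T(2) by (auto simp: centers_def)
  qed
  have CK: "centers K \<subseteq> K" by (auto simp: centers_def)
  show ?thesis
  proof (intro equalityI subsetI)
    show "y \<in> centers K" if "y \<in> T ` centers K" for y using that iff CK by auto
    fix y assume y: "y \<in> centers K"
    then obtain x where "x \<in> K" "y = T x" using CK T(2) by blast
    then show "y \<in> T ` centers K" using iff y by blast
  qed
qed

section \<open>Minimal invariant sets\<close>

lemma random_isometric_subset:
  "\<lbrakk>random_isometric M nrm G T; K \<subseteq> G\<rbrakk> \<Longrightarrow> random_isometric M nrm K T"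
  by (auto simp: random_isometric_def)

lemma random_isometric_inj_on:
  assumes T: "random_isometric M nrm G T"
  shows "inj_on T G"
proof (rule inj_onI)
  fix x y assume xy: "x \<in> G" "y \<in> G" "T x = T y"
  have "AE w in M. nrm (T x - T y) w = nrm (x - y) w"
    using T xy(1,2) by (auto simp: random_isometric_def)
  then have "AE w in M. nrm (x - y) w = 0"
    using nrm_zero unfolding xy(3) diff_self by eventually_elim simp
  then show "x = y" using nrm_eq_zero[of "x - y"] by simp
qed

lemma as_bounded_subset:
  assumes "H \<noteq> {}" and b: "b \<in> borel_measurable M" "\<And>y. y \<in> H \<Longrightarrow> AE w in M. nrm y w \<le> b w"
  shows "as_bounded M nrm H"
proof -
  let ?F = "{\<lambda>w. ereal (nrm g w) |g. g \<in> H}"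
  have F: "?F \<subseteq> borel_measurable M" by auto
  obtain h where h: "h \<in> H" using assms(1) by auto
  have "AE w in M. ereal (nrm h w) \<le> L0_Sup M ?F w" using h by (intro L0_Sup_upper[OF F]) auto
  moreover have "AE w in M. L0_Sup M ?F w \<le> ereal (b w)"
    using b by (intro L0_Sup_least[OF F]) auto
  ultimately show ?thesis unfolding as_bounded_def using nrm_nonneg[of h]
  proof eventually_elim
    case (elim w)
    then have "0 \<le> ereal (nrm h w)" by simp
    with elim(1) have "0 \<le> L0_Sup M ?F w" by (rule order_trans[rotated])
    with elim(2) show ?case by auto
  qed
qed

text \<open>
  If every point of \<open>K\<close> is a center, all radii agree with the radius at the point \<open>z\<close> that normal
  structure provides.  Then the diameter is at most \<open>R(K, z)\<close>, which is smaller wherever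
  the diameter is positive; so the diameter vanishes.
\<close>

lemma all_centers_singleton:
  assumes bnd: "as_bounded M nrm K" and G: "random_normal_structure M smul nrm G"
    and KG: "K \<subseteq> G" and K: "K \<noteq> {}" "closedin (el_topology M nrm) K" "L0_convex M smul K"
    and all: "centers K = K"
  shows "\<exists>x. K = {x}"
proof -
  let ?D = "random_diam M nrm K"
  let ?F = "{\<lambda>w. ereal (nrm (x - y) w) |x y. x \<in> K \<and> y \<in> K}"
  have F: "?F \<subseteq> borel_measurable M" by auto
  obtain x0 where x0: "x0 \<in> K" using K(1) by auto
  have up: "AE w in M. ereal (nrm (x - y) w) \<le> ?D w" if "x \<in> K" "y \<in> K" for x y
    unfolding random_diam_def using that by (intro L0_Sup_upper[OF F]) blast
  have D0: "AE w in M. 0 \<le> ?D w"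
    using up[OF x0 x0] nrm_zero by eventually_elim (simp add: zero_ereal_def)
  have "AE w in M. ?D w = 0"
  proof (rule ccontr)
    assume n0: "\<not> ?thesis"
    then obtain z where z: "z \<in> K" "AE w in M. 0 < ?D w \<longrightarrow> rad_pt M nrm K z w < ?D w"
      using G KG K bnd D0 unfolding random_normal_structure_def by blast
    have "AE w in M. ?D w \<le> rad_pt M nrm K z w"
      unfolding random_diam_def
    proof (rule L0_Sup_least[OF F])
      fix f assume "f \<in> ?F"
      then obtain x y where f: "f = (\<lambda>w. ereal (nrm (x - y) w))" "x \<in> K" "y \<in> K" by blast
      then have "AE w in M. rad_pt M nrm K x w \<le> rad_pt M nrm K z w"
        using all z(1) by (auto simp: centers_def)
      then show "AE w in M. f w \<le> rad_pt M nrm K z w"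
        using rad_pt_upper[OF f(3), of x] unfolding f(1) by eventually_elim (rule order_trans)
    qed measurable
    with z(2) D0 have "AE w in M. ?D w = 0" by eventually_elim (auto simp: not_le[symmetric])
    with n0 show False by simp
  qed
  have "x = x0" if x: "x \<in> K" for x
  proof -
    have "AE w in M. nrm (x - x0) w = 0"
      using up[OF x x0] \<open>AE w in M. ?D w = 0\<close> nrm_nonneg[of "x - x0"] by eventually_elim (simp add: zero_ereal_def)
    then show ?thesis using nrm_eq_zero[of "x - x0"] by simp
  qed
  with x0 show ?thesis by blast
qed

end

text \<open>
  Zorn's lemma for the reverse inclusion, by passing to complements.
\<close>

lemma minimal_member:
  assumes ne: "\<F> \<noteq> {}"
    and Inter: "\<And>\<C>. \<lbrakk>\<C> \<noteq> {}; \<C> \<subseteq> \<F>; \<And>A B. \<lbrakk>A \<in> \<C>; B \<in> \<C>\<rbrakk> \<Longrightarrow> A \<subseteq> B \<or> B \<subseteq> A\<rbrakk> \<Longrightarrow> \<Inter>\<C> \<in> \<F>"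
  shows "\<exists>K\<in>\<F>. \<forall>L\<in>\<F>. L \<subseteq> K \<longrightarrow> L = K"
proof -
  have "\<exists>K\<in>uminus ` \<F>. \<forall>X\<in>uminus ` \<F>. K \<subseteq> X \<longrightarrow> X = K"
  proof (rule subset_Zorn_nonempty)
    show "uminus ` \<F> \<noteq> {}" using ne by simp
    fix \<D> assume D: "\<D> \<noteq> {}" "subset.chain (uminus ` \<F>) \<D>"
    have sub: "\<D> \<subseteq> uminus ` \<F>" and ch: "\<And>A B. \<lbrakk>A \<in> \<D>; B \<in> \<D>\<rbrakk> \<Longrightarrow> A \<subseteq> B \<or> B \<subseteq> A"
      using D(2) by (auto simp: subset_chain_def)
    have "\<Inter>(uminus ` \<D>) \<in> \<F>"
    proof (rule Inter)
      show "uminus ` \<D> \<noteq> {}" using D(1) by simp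
      show "uminus ` \<D> \<subseteq> \<F>" using sub by auto
      show "A \<subseteq> B \<or> B \<subseteq> A" if "A \<in> uminus ` \<D>" "B \<in> uminus ` \<D>" for A B
        using that ch by (auto simp only: image_iff Compl_subset_Compl_iff)
    qed
    moreover have "\<Union>\<D> = - \<Inter>(uminus ` \<D>)" by auto
    ultimately show "\<Union>\<D> \<in> uminus ` \<F>" by blast
  qed
  then obtain K where K: "K \<in> \<F>" "\<And>L. L \<in> \<F> \<Longrightarrow> - K \<subseteq> - L \<Longrightarrow> - L = - K" by auto
  have "L = K" if "L \<in> \<F>" "L \<subseteq> K" for L
  proof -
    have "- L = - K" using that by (intro K(2)) auto
    then show ?thesis by simp
  qed
  with K(1) show ?thesis by blast
qed

theorem theorem1p17:
  fixes M :: "'w measure"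
    and smul :: "('w \<Rightarrow> 'k::{real_normed_field,euclidean_space}) \<Rightarrow> 'e::ab_group_add \<Rightarrow> 'e"
    and nrm :: "'e \<Rightarrow> 'w \<Rightarrow> real"
    and G :: "'e set"
    and \<T> :: "('e \<Rightarrow> 'e) set"
  assumes "rn_module M smul nrm"
    and "el_complete M nrm"
    and "L0_convexly_compact M smul nrm G"
    and "random_normal_structure M smul nrm G"
    and "\<And>T. T \<in> \<T> \<Longrightarrow> T ` G = G \<and> random_isometric M nrm G T"
  shows "\<exists>x \<in> random_center M nrm G G. \<forall>T\<in>\<T>. T x = x"
proof -
  interpret rn_module M smul nrm by fact
  note G = assms(3)
  have G0: "G \<noteq> {}" "closedin (el_topology M nrm) G" "L0_convex M smul G"
    using G by (auto simp: L0_convexly_compact_def)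
  have TG: "T ` G = G" "random_isometric M nrm G T" if "T \<in> \<T>" for T using assms(5)[OF that] by auto
  obtain b where b: "b \<in> borel_measurable M" "\<And>g. g \<in> G \<Longrightarrow> AE w in M. nrm g w \<le> b w"
    using convexly_compact_bounded[OF G] by blast
  define C where "C = centers G"
  have CG: "C \<subseteq> G" by (auto simp: C_def centers_def)
  have C: "C \<noteq> {}" "closedin (el_topology M nrm) C" "L0_convex M smul C"
    unfolding C_def by (rule centers_closed_convex[OF G order_refl G0])+
  have TC: "T ` C = C" if "T \<in> \<T>" for T
    unfolding C_def using TG[OF that] by (intro isometry_image_centers)
  define \<F> where "\<F> = {K. K \<subseteq> C \<and> K \<noteq> {} \<and> closedin (el_topology M nrm) K \<and> L0_convex M smul K \<and>
    (\<forall>T\<in>\<T>. T ` K = K)}"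
  have "\<exists>K\<in>\<F>. \<forall>L\<in>\<F>. L \<subseteq> K \<longrightarrow> L = K"
  proof (rule minimal_member[of \<F>])
    have "C \<in> \<F>" using C TC by (simp add: \<F>_def)
    then show "\<F> \<noteq> {}" by blast
    fix \<C> assume ne: "\<C> \<noteq> {}" and sub: "\<C> \<subseteq> \<F>"
      and ch: "\<And>A B. \<lbrakk>A \<in> \<C>; B \<in> \<C>\<rbrakk> \<Longrightarrow> A \<subseteq> B \<or> B \<subseteq> A"
    have mem: "A \<subseteq> C" "A \<noteq> {}" "closedin (el_topology M nrm) A" "L0_convex M smul A"
      "\<And>T. T \<in> \<T> \<Longrightarrow> T ` A = A" if "A \<in> \<C>" for A using that sub by (auto simp: \<F>_def)
    have fip: "\<Inter>\<D> \<noteq> {}" if "\<D> \<subseteq> \<C>" "finite \<D>" for \<D>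
    proof (cases "\<D> = {}")
      case False
      have "subset.chain \<C> \<D>" using that(1) ch unfolding subset_chain_def by blast
      then have "\<Inter>\<D> \<in> \<D>" by (rule Inter_in_chain[OF that(2) False])
      then show ?thesis using that(1) mem(2) by blast
    qed simp
    have cc: "\<forall>A\<in>\<C>. A \<subseteq> G \<and> closedin (el_topology M nrm) A \<and> L0_convex M smul A"
      using mem CG by blast
    have "\<Inter>\<C> \<noteq> {}" by (rule L0_convexly_compact_Inter[OF G cc]) (rule fip)
    moreover have "closedin (el_topology M nrm) (\<Inter>\<C>)" using ne mem(3) by (intro closedin_Inter)
    moreover have "T ` \<Inter>\<C> = \<Inter>\<C>" if T: "T \<in> \<T>" for T
    proof -
      \<comment> \<open>Isometries are injective, so images commute with intersections.\<close>
      have "T ` (\<Inter>A\<in>\<C>. A) = (\<Inter>A\<in>\<C>. T ` A)"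
        using ne mem(1) CG random_isometric_inj_on[OF TG(2)[OF T]]
        by (intro image_INT[where C = G and j = "SOME A. A \<in> \<C>"]) (auto simp: some_in_eq)
      then show ?thesis using mem(5)[OF _ T] by simp
    qed
    moreover have "\<Inter>\<C> \<subseteq> C" using ne mem(1) by blast
    ultimately show "\<Inter>\<C> \<in> \<F>" using L0_convex_Inter[of \<C>] mem(4) by (simp add: \<F>_def)
  qed
  then obtain K where KF: "K \<in> \<F>" and min: "\<And>L. \<lbrakk>L \<in> \<F>; L \<subseteq> K\<rbrakk> \<Longrightarrow> L = K"
    by blast
  have K: "K \<noteq> {}" "closedin (el_topology M nrm) K" "L0_convex M smul K" and KC: "K \<subseteq> C"
    and TK: "\<And>T. T \<in> \<T> \<Longrightarrow> T ` K = K" using KF by (auto simp: \<F>_def)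
  have KG: "K \<subseteq> G" using KC CG by blast
  have sub: "centers K \<subseteq> K" by (auto simp: centers_def)
  have "T ` centers K = centers K" if "T \<in> \<T>" for T
    using random_isometric_subset[OF TG(2)[OF that] KG] TK[OF that] by (rule isometry_image_centers)
  then have "centers K \<in> \<F>"
    using centers_closed_convex[OF G KG K] sub KC by (auto simp: \<F>_def)
  then have all: "centers K = K" using sub by (rule min)
  have "as_bounded M nrm K" by (rule as_bounded_subset[OF K(1) b(1)]) (use b(2) KG in blast)
  then obtain x where x: "K = {x}"
    using all_centers_singleton[OF _ assms(4) KG K all] by blast
  have "x \<in> random_center M nrm G G"
    using random_center_eq_centers[of G] C(1) KC x by (auto simp: C_def)
  moreover have "\<forall>T\<in>\<T>. T x = x" using TK x by auto
  ultimately show ?thesis by blast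
qed

end
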